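(* Let $H$ be a separable infinite-dimensional complex Hilbert space, let $p\ge1$, and let $\alpha:\mathbb{N}_0\to[0,\infty)$ be a monotone increasing function with $\alpha(0)=0$ and $\alpha(1)>0$. Assume that $\alpha$ is concave. Let $\varphi_\alpha$ be the non-linear trace of Choquet type associated with $\alpha$, and $|||a|||_{\alpha,p}:=\varphi_\alpha(|a|^p)^{1/p}$ for $a\in K(H)$. Then the weighted Schatten-von Neumann $p$-class $\mathcal{C}^\alpha_p(H)=\{a\in K(H):|||a|||_{\alpha,p}<\infty\}$ is a Banach space with respect to the norm $|||\cdot|||_{\alpha,p}$. Moreover $\mathcal{C}^\alpha_p(H)$ is a $*$-ideal of $B(H)$.
   Context: $\mathbb{N}_0=\{0,1,2,\dots\}$; $B(H)$ is the algebra of bounded linear operators on $H$, $K(H)$ the algebra of compact operators, $K(H)^+$ its positive elements, $|a|=(a^*a)^{1/2}$. For $a\in K(H)^+$, $\lambda_1(a)\ge\lambda_2(a)\ge\cdots$ denotes the sequence of nonzero eigenvalues of $a$ in decreasing order counted with multiplicity (completed by zeros if $a$ has finite rank). The non-linear trace of Choquet type associated with $\alpha$ is $\varphi_\alpha:K(H)^+\to[0,\infty]$, $\varphi_\alpha(a)=\sum_{i=1}^\infty(\lambda_i(a)-\lambda_{i+1}(a))\alpha(i)$. Concave means $\frac{\alpha(i+1)+\alpha(i-1)}{2}\le\alpha(i)$ for $i=1,2,3,\dots$. A $*$-ideal is a two-sided ideal closed under taking adjoints. *)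

theory Defs
  imports "HOL-Analysis.Analysis" "HOL-Computational_Algebra.Polynomial"
begin

section \<open>Complex Hilbert spaces\<close>

text \<open>The inner product is linear in the first and conjugate linear in the second argument.
  Completeness is part of the class \<^class>\<open>banach\<close>.\<close>

class complex_hilbert_space = banach +
  fixes scaleC :: "complex \<Rightarrow> 'a \<Rightarrow> 'a" (infixr "*\<^sub>C" 75)
    and cinner :: "'a \<Rightarrow> 'a \<Rightarrow> complex"
  assumes scaleC_add_right: "c *\<^sub>C (x + y) = c *\<^sub>C x + c *\<^sub>C y"
    and scaleC_add_left: "(c + d) *\<^sub>C x = c *\<^sub>C x + d *\<^sub>C x"
    and scaleC_scaleC: "c *\<^sub>C (d *\<^sub>C x) = (c * d) *\<^sub>C x"
    and scaleC_one: "1 *\<^sub>C x = x"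
    and scaleR_scaleC: "r *\<^sub>R x = complex_of_real r *\<^sub>C x"
    and cinner_commute: "cinner x y = cnj (cinner y x)"
    and cinner_add_left: "cinner (x + y) z = cinner x z + cinner y z"
    and cinner_scaleC_left: "cinner (c *\<^sub>C x) y = c * cinner x y"
    and cinner_ge_zero: "0 \<le> Re (cinner x x)"
    and cinner_eq_zero_iff: "cinner x x = 0 \<longleftrightarrow> x = 0"
    and norm_eq_sqrt_cinner: "norm x = sqrt (Re (cinner x x))"

global_interpretation cvec: vector_space "scaleC :: complex \<Rightarrow> 'h \<Rightarrow> 'h::complex_hilbert_space"
  by unfold_locales (simp_all add: scaleC_add_right scaleC_add_left scaleC_scaleC scaleC_one)

lemma norm_scaleC: "norm (c *\<^sub>C (x::'h::complex_hilbert_space)) = cmod c * norm x"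
proof -
  have "cinner (c *\<^sub>C x) (c *\<^sub>C x) = (c * cnj c) * cinner x x"
    by (subst cinner_scaleC_left, subst cinner_commute, subst cinner_scaleC_left)
       (use cinner_commute[of x x] in simp)
  also have "c * cnj c = complex_of_real ((cmod c)\<^sup>2)"
    by (simp only: complex_norm_square)
  finally have "Re (cinner (c *\<^sub>C x) (c *\<^sub>C x)) = (cmod c)\<^sup>2 * Re (cinner x x)"
    by simp
  then show ?thesis
    by (simp add: norm_eq_sqrt_cinner real_sqrt_mult)
qed

lemma bounded_linear_scaleC:
  "bounded_linear (\<lambda>x. c *\<^sub>C (x::'h::complex_hilbert_space))"
proof (rule bounded_linear_intro[where K = "cmod c"])
  show "c *\<^sub>C (r *\<^sub>R x) = r *\<^sub>R (c *\<^sub>C x)" for r and x :: 'h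
    by (simp add: scaleR_scaleC scaleC_scaleC mult.commute)
qed (simp_all add: scaleC_add_right norm_scaleC mult.commute)


section \<open>Operators\<close>

text \<open>The type \<open>'h \<Rightarrow>\<^sub>L 'h\<close> consists of the bounded \<^emph>\<open>real\<close>-linear operators with the operator
  norm; \<open>B(H)\<close> is the subset of the complex-linear ones.\<close>

type_synonym 'h op = "'h \<Rightarrow>\<^sub>L 'h"

definition bounded_ops :: "'h::complex_hilbert_space op set" where
  "bounded_ops = {a. \<forall>c x. blinfun_apply a (c *\<^sub>C x) = c *\<^sub>C blinfun_apply a x}"

definition compact_ops :: "'h::complex_hilbert_space op set" where
  "compact_ops = {a \<in> bounded_ops. compact (closure (blinfun_apply a ` cball 0 1))}"

lift_definition op_scaleC :: "complex \<Rightarrow> 'h op \<Rightarrow> 'h::complex_hilbert_space op"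
  is "\<lambda>c a x. c *\<^sub>C a x"
  by (rule bounded_linear_compose[OF bounded_linear_scaleC])

global_interpretation opvec:
  vector_space "op_scaleC :: complex \<Rightarrow> 'h op \<Rightarrow> 'h::complex_hilbert_space op"
  by unfold_locales
    (transfer; simp add: fun_eq_iff scaleC_add_right scaleC_add_left scaleC_scaleC scaleC_one)+

definition adj :: "'h op \<Rightarrow> 'h::complex_hilbert_space op" where
  "adj a = (THE b. b \<in> bounded_ops \<and>
     (\<forall>x y. cinner (blinfun_apply a x) y = cinner x (blinfun_apply b y)))"


section \<open>Continuous functional calculus for positive operators\<close>

definition op_poly :: "real poly \<Rightarrow> 'h op \<Rightarrow> 'h::complex_hilbert_space op" where
  "op_poly q a = (\<Sum>i\<le>degree q. coeff q i *\<^sub>R (((o\<^sub>L) a ^^ i) id_blinfun))"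

text \<open>The spectrum of a positive operator \<open>a\<close> is contained in \<open>[0, \<parallel>a\<parallel>]\<close>. For continuous \<open>f\<close> on
  this interval, \<open>f(a)\<close> is the common norm limit of \<open>q\<^sub>n(a)\<close> over all sequences of polynomials
  \<open>q\<^sub>n\<close> converging to \<open>f\<close> uniformly; such sequences exist by the Weierstrass theorem.\<close>

definition op_cfc :: "(real \<Rightarrow> real) \<Rightarrow> 'h op \<Rightarrow> 'h::complex_hilbert_space op" where
  "op_cfc f a = (THE b. \<forall>q :: nat \<Rightarrow> real poly.
     uniform_limit {0..norm a} (\<lambda>n. poly (q n)) f sequentially \<longrightarrow>
     (\<lambda>n. op_poly (q n) a) \<longlonglongrightarrow> b)"

definition op_powr :: "'h op \<Rightarrow> real \<Rightarrow> 'h::complex_hilbert_space op" where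
  "op_powr a r = op_cfc (\<lambda>t. t powr r) a"

definition op_abs :: "'h op \<Rightarrow> 'h::complex_hilbert_space op" where
  "op_abs a = op_powr (adj a o\<^sub>L a) (1/2)"


section \<open>Eigenvalue sequence and the trace of Choquet type\<close>

text \<open>A sequence enumerates the nonzero eigenvalues of a positive compact operator in decreasing
  order, with multiplicity and completed by zeros, if it is decreasing and nonnegative and each
  \<open>t > 0\<close> occurs in it as often as the dimension of its eigenspace says. Finiteness
  is required separately because \<open>card\<close> of an infinite set is \<open>0\<close>.
  Sequences start at \<open>0\<close>, so \<open>eigval a i\<close> is \<open>\<lambda>\<^sub>i\<^sub>+\<^sub>1(a)\<close>.\<close>

definition is_eigval_seq :: "'h::complex_hilbert_space op \<Rightarrow> (nat \<Rightarrow> real) \<Rightarrow> bool" where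
  "is_eigval_seq a l \<longleftrightarrow> decseq l \<and> (\<forall>i. 0 \<le> l i) \<and>
     (\<forall>t>0. finite {i. l i = t} \<and>
        card {i. l i = t} = cvec.dim {x. blinfun_apply a x = complex_of_real t *\<^sub>C x})"

definition eigval :: "'h::complex_hilbert_space op \<Rightarrow> nat \<Rightarrow> real" where
  "eigval a = (THE l. is_eigval_seq a l)"

text \<open>The terms are \<open>(\<lambda>\<^sub>i - \<lambda>\<^sub>i\<^sub>+\<^sub>1) \<alpha>(i)\<close> for \<open>i \<ge> 1\<close>, with \<open>i\<close> shifted by one.\<close>

definition choquet_trace :: "(nat \<Rightarrow> real) \<Rightarrow> 'h::complex_hilbert_space op \<Rightarrow> ennreal" where
  "choquet_trace \<alpha> a = (\<Sum>i. ennreal ((eigval a i - eigval a (Suc i)) * \<alpha> (Suc i)))"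

definition schatten_norm ::
  "(nat \<Rightarrow> real) \<Rightarrow> real \<Rightarrow> 'h::complex_hilbert_space op \<Rightarrow> ennreal" where
  "schatten_norm \<alpha> p a =
     (let s = choquet_trace \<alpha> (op_powr (op_abs a) p)
      in if s = \<infinity> then \<infinity> else ennreal (enn2real s powr (1/p)))"

definition schatten_class ::
  "(nat \<Rightarrow> real) \<Rightarrow> real \<Rightarrow> 'h::complex_hilbert_space op set" where
  "schatten_class \<alpha> p = {a \<in> compact_ops. schatten_norm \<alpha> p a < \<infinity>}"


section \<open>Banach spaces of operators and ideals\<close>

definition op_banach_space ::
  "'h::complex_hilbert_space op set \<Rightarrow> ('h op \<Rightarrow> real) \<Rightarrow> bool" where
  "op_banach_space C N \<longleftrightarrow>
     opvec.subspace C \<and>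
     (\<forall>a\<in>C. 0 \<le> N a \<and> (N a = 0 \<longleftrightarrow> a = 0)) \<and>
     (\<forall>c. \<forall>a\<in>C. N (op_scaleC c a) = cmod c * N a) \<and>
     (\<forall>a\<in>C. \<forall>b\<in>C. N (a + b) \<le> N a + N b) \<and>
     (\<forall>s :: nat \<Rightarrow> 'h op. (\<forall>n. s n \<in> C) \<longrightarrow>
        (\<forall>e>0. \<exists>M. \<forall>m\<ge>M. \<forall>n\<ge>M. N (s m - s n) < e) \<longrightarrow>
        (\<exists>a\<in>C. (\<lambda>n. N (s n - a)) \<longlonglongrightarrow> 0))"

definition star_ideal :: "'h::complex_hilbert_space op set \<Rightarrow> bool" where
  "star_ideal J \<longleftrightarrow> J \<subseteq> bounded_ops \<and> opvec.subspace J \<and>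
     (\<forall>a\<in>J. \<forall>b\<in>bounded_ops. (a o\<^sub>L b) \<in> J \<and> (b o\<^sub>L a) \<in> J) \<and>
     (\<forall>a\<in>J. adj a \<in> J)"

end

theory Submission
  imports Defs
begin

text \<open>
  Let \<open>s\<^sub>i(a)\<close> be the singular values of a compact operator and \<open>w\<^sub>i = \<alpha>(i+1) - \<alpha>(i)\<close>; concavity
  of \<open>\<alpha>\<close> says that \<open>w\<close> decreases. Summation by parts turns the Choquet trace into
  \<open>\<phi>\<^sub>\<alpha>(\<bar>a\<bar>\<^sup>p) = \<Sum> w\<^sub>i s\<^sub>i(a)\<^sup>p\<close>. By Ky Fan's maximum principle the partial sums \<open>\<Sum>\<^bsub>i<k\<^esub> s\<^sub>i(a)\<close> are
  the maxima of \<open>\<bar>\<Sum>\<^bsub>i<k\<^esub> \<langle>a f\<^sub>i, g\<^sub>i\<rangle>\<bar>\<close> over Bessel sequences \<open>f\<close>, \<open>g\<close>, so they are subadditive in \<open>a\<close>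
  and behave well under adjoints and under composition with bounded operators. Since the weights
  decrease, such domination of partial sums passes to the weighted norms, which gives the triangle
  inequality and the ideal property. The weighted norm dominates a multiple of the operator norm
  and each \<open>s\<^sub>i\<close> is norm continuous, so a Cauchy sequence converges in operator norm and, by a
  Fatou argument on the finite partial sums, in the weighted norm.
\<close>


section \<open>Inner products and adjoints\<close>

text \<open>\<open>adj\<close>, \<open>op_cfc\<close> and \<open>eigval\<close> are definite
  descriptions, so nothing can be computed from them before existence and uniqueness are known. The
  device for the last two is diagonalisation: the spectral theorem is applied to the single operator
  a*a, and the orthonormal sequence found there also diagonalises |a| and its powers, so that
  functional calculus and multiplicities can be read off. Because H is infinite-dimensional, this
  sequence is indexed by all of nat, with eigenvalue 0 allowed; finite rank is no separate case.
  Bessel sequences appear in the maximum principle because a contraction maps them to Bessel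
  sequences, whereas it need not preserve orthonormality. Domination is available for sums of s_i,
  while the norm involves s_i^p. The bridge is that w_i s_i^(p-1) is again a decreasing weight,
  against which s_i enters linearly; Hoelder's inequality then restores the p-norms. Estimates are
  made on truncations to n terms, uniformly in n, so infinite values enter only at the interface
  with the trace.\<close>

lemma cinner_add_right:
  fixes x :: "'h::complex_hilbert_space"
  shows "cinner x (y + z) = cinner x y + cinner x z"
  by (metis cinner_add_left cinner_commute complex_cnj_add)

lemma cinner_scaleC_right:
  fixes x :: "'h::complex_hilbert_space"
  shows "cinner x (c *\<^sub>C y) = cnj c * cinner x y"
  by (metis cinner_scaleC_left cinner_commute complex_cnj_mult)

lemma cinner_self:
  fixes x :: "'h::complex_hilbert_space"
  shows "cinner x x = complex_of_real ((norm x)\<^sup>2)"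
proof -
  have "cinner x x = cnj (cinner x x)" by (rule cinner_commute)
  then have "Im (cinner x x) = 0" by (simp add: complex_eq_iff)
  then show ?thesis by (simp add: norm_eq_sqrt_cinner cinner_ge_zero complex_eq_iff)
qed

lemma cauchy_schwarz:
  fixes x :: "'h::complex_hilbert_space"
  shows "cmod (cinner x y) \<le> norm x * norm y"
proof (cases "y = 0")
  case True
  have "cinner x 0 = 0" using cinner_scaleC_right[of x 0 0] by simp
  then show ?thesis using True by simp
next
  case False
  define c where "c = cinner x y"
  define t where "t = complex_of_real (1 / (norm y)\<^sup>2)"
  \<comment> \<open>The component of x orthogonal to y; its squared norm is |x|^2 - |c|^2 /
    |y|^2.\<close>
  define z where "z = x + (- c * t) *\<^sub>C y"
  have yx: "cinner y x = cnj c" unfolding c_def by (rule cinner_commute)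
  have ty: "t * complex_of_real ((norm y)\<^sup>2) = 1"
    using False by (simp add: t_def)
  have ct: "cnj t = t" by (simp add: t_def)
  have "cinner z z = cinner x x - cnj c * t * c - c * t * cnj c + c * t * cnj c * t * complex_of_real ((norm y)\<^sup>2)"
    unfolding z_def cinner_add_left cinner_add_right cinner_scaleC_left cinner_scaleC_right
      cinner_self[of y] yx c_def[symmetric]
    by (simp add: ct algebra_simps)
  also have "\<dots> = cinner x x - c * cnj c * t"
    using ty by (simp add: algebra_simps)
  also have "\<dots> = complex_of_real ((norm x)\<^sup>2 - (cmod c)\<^sup>2 / (norm y)\<^sup>2)"
    unfolding complex_norm_square[symmetric] by (simp add: cinner_self t_def)
  finally have "0 \<le> (norm x)\<^sup>2 - (cmod c)\<^sup>2 / (norm y)\<^sup>2"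
    using cinner_ge_zero[of z] by simp
  then have "(cmod c)\<^sup>2 \<le> (norm x * norm y)\<^sup>2"
    using False by (simp add: field_simps power_mult_distrib)
  then show ?thesis unfolding c_def
    by (meson norm_ge_zero mult_nonneg_nonneg power2_le_imp_le)
qed

lemma bounded_bilinear_cinner:
  "bounded_bilinear (cinner :: 'h \<Rightarrow> 'h \<Rightarrow> complex)"
  if "SORT_CONSTRAINT('h::complex_hilbert_space)"
proof
  fix a a' b b' :: 'h and r :: real
  show "cinner (r *\<^sub>R a) b = r *\<^sub>R cinner a b"
    by (simp add: scaleR_scaleC cinner_scaleC_left scaleR_conv_of_real)
  show "cinner a (r *\<^sub>R b) = r *\<^sub>R cinner a b"
    by (simp add: scaleR_scaleC cinner_scaleC_right scaleR_conv_of_real)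
  show "\<exists>K. \<forall>a b::'h. cmod (cinner a b) \<le> norm a * norm b * K"
    by (rule exI[of _ 1]) (simp add: cauchy_schwarz)
qed (simp_all add: cinner_add_left cinner_add_right)

interpretation cinner: bounded_bilinear "cinner :: 'h::complex_hilbert_space \<Rightarrow> 'h \<Rightarrow> complex"
  by (rule bounded_bilinear_cinner)


lemma cinner_ext:
  fixes y :: "'h::complex_hilbert_space"
  assumes "\<And>x. cinner x y = cinner x z"
  shows "y = z"
proof -
  have "cinner (y - z) (y - z) = 0"
    using assms[of "y - z"] by (simp add: cinner.diff_right)
  then show ?thesis by (simp add: cinner_eq_zero_iff)
qed

lemma cinner_eq_zero_commute:
  fixes x :: "'h::complex_hilbert_space"
  shows "cinner x y = 0 \<longleftrightarrow> cinner y x = 0"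
  by (metis cinner_commute complex_cnj_zero)

lemma norm_add_square:
  fixes x :: "'h::complex_hilbert_space"
  shows "(norm (x + y))\<^sup>2 = (norm x)\<^sup>2 + 2 * Re (cinner x y) + (norm y)\<^sup>2"
proof -
  have "complex_of_real ((norm (x + y))\<^sup>2) = cinner x x + cinner x y + cinner y x + cinner y y"
    by (simp only: cinner_self[symmetric] cinner_add_left cinner_add_right add_ac)
  also have "cinner y x = cnj (cinner x y)" by (rule cinner_commute)
  finally have "Re (complex_of_real ((norm (x + y))\<^sup>2)) = Re (cinner x x + cinner x y + cnj (cinner x y) + cinner y y)"
    by (simp only:)
  then show ?thesis by (simp add: cinner_self del: of_real_power)
qed

lemma norm_diff_square:
  fixes x :: "'h::complex_hilbert_space"
  shows "(norm (x - y))\<^sup>2 = (norm x)\<^sup>2 - 2 * Re (cinner x y) + (norm y)\<^sup>2"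
  using norm_add_square[of x "- y"] by (simp add: cinner.minus_right)

text \<open>First-order condition at a minimum. The \<open>A + 1\<close> in the choice of
  \<open>t\<close> covers A = 0 and makes the quadratic equal to -t^2.\<close>

lemma quadratic_nonneg_imp_linear_zero:
  fixes A B :: real
  assumes "0 \<le> A" and nn: "\<And>t. 0 \<le> t\<^sup>2 * A + t * B"
  shows "B = 0"
proof (rule ccontr)
  assume "B \<noteq> 0"
  define t where "t = - B / (A + 1)"
  have B: "B = - t * (A + 1)" using assms(1) by (simp add: t_def)
  have "t\<^sup>2 * A + t * B = - (t\<^sup>2)"
    unfolding B by (simp add: power2_eq_square algebra_simps)
  moreover have "t \<noteq> 0" using \<open>B \<noteq> 0\<close> assms(1) by (simp add: t_def)
  ultimately show False using nn[of t] by simp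
qed

text \<open>If f = <., z>, then J(x) = |x - z|^2 - |z|^2, so z has to be the minimiser of J.
  Completeness provides a minimiser, and the first-order condition there gives back f.\<close>

lemma riesz_representation:
  fixes f :: "'h::complex_hilbert_space \<Rightarrow> complex"
  assumes bl: "bounded_linear f" and hom: "\<And>c x. f (c *\<^sub>C x) = c * f x"
  shows "\<exists>z. \<forall>x. f x = cinner x z"
proof -
  interpret f: bounded_linear f by (rule bl)
  obtain K where K: "\<And>x. cmod (f x) \<le> norm x * K" using f.bounded by blast
  define J where "J x = (norm x)\<^sup>2 - 2 * Re (f x)" for x
  define d where "d = Inf (range J)"
  have lower: "- (K\<^sup>2) \<le> J x" for x
  proof -
    have "Re (f x) \<le> norm x * K" using K[of x] complex_Re_le_cmod order_trans by blast
    moreover have "0 \<le> (norm x - K)\<^sup>2" by simp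
    ultimately show ?thesis by (simp add: J_def power2_diff mult.commute)
  qed
  have d: "d \<le> J x" for x
    unfolding d_def by (rule cInf_lower) (auto intro!: bdd_belowI[of _ "- (K\<^sup>2)"] lower)
  \<comment> \<open>The parallelogram law: the real-linear part of J cancels against the midpoint,
    so near-minimisers are close to each other.\<close>
  have para: "(norm (x - y))\<^sup>2 \<le> 2 * (J x + J y - 2 * d)" for x y
  proof -
    have "(norm ((1/2) *\<^sub>R (x + y)))\<^sup>2 = (norm (x + y))\<^sup>2 / 4"
      by (simp add: power_divide)
    moreover have "Re (f ((1/2) *\<^sub>R (x + y))) = (Re (f x) + Re (f y)) / 2"
      by (simp only: f.scaleR f.add) simp
    ultimately have "J x + J y - 2 * J ((1/2) *\<^sub>R (x + y)) = (norm (x - y))\<^sup>2 / 2"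
      unfolding J_def norm_add_square[of x y] norm_diff_square[of x y] by (simp add: field_simps)
    then show ?thesis using d[of "(1/2) *\<^sub>R (x + y)"] by simp
  qed
  have "\<exists>x. J x < d + 1 / real (Suc n)" for n
  proof -
    have "\<exists>r\<in>range J. r < d + 1 / real (Suc n)"
      unfolding d_def by (rule cInf_lessD) auto
    then show ?thesis by auto
  qed
  then obtain s where s: "\<And>n. J (s n) < d + 1 / real (Suc n)" by metis
  have "Cauchy s"
  proof (rule metric_CauchyI)
    fix e :: real assume "0 < e"
    then obtain M where M: "4 * (1 / real (Suc M)) < e\<^sup>2"
      using reals_Archimedean[of "e\<^sup>2 / 4"] by (auto simp: field_simps)
    have "dist (s m) (s n) < e" if "M \<le> m" "M \<le> n" for m n
    proof -
      have "1 / real (Suc m) \<le> 1 / real (Suc M)" "1 / real (Suc n) \<le> 1 / real (Suc M)"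
        using that by (simp_all add: frac_le)
      then have "(norm (s m - s n))\<^sup>2 < e\<^sup>2"
        using para[of "s m" "s n"] s[of m] s[of n] M
        by (smt (verit, best) distrib_left)
      then show ?thesis
        using \<open>0 < e\<close> by (simp add: dist_norm power_less_imp_less_base)
    qed
    then show "\<exists>M. \<forall>m\<ge>M. \<forall>n\<ge>M. dist (s m) (s n) < e" by blast
  qed
  then obtain z where z: "s \<longlonglongrightarrow> z" using Cauchy_convergent convergent_def by blast
  have "(\<lambda>n. J (s n)) \<longlonglongrightarrow> J z"
    unfolding J_def by (intro tendsto_intros z f.tendsto)
  moreover have "(\<lambda>n. d + 1 / real (Suc n)) \<longlonglongrightarrow> d + 0"
    by (intro tendsto_intros LIMSEQ_Suc[OF lim_1_over_n])
  ultimately have "J z \<le> d + 0"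
    by (rule LIMSEQ_le) (use s in \<open>auto intro: less_imp_le\<close>)
  then have min: "J z \<le> J x" for x using d[of x] by simp
  have Re: "Re (f h) = Re (cinner h z)" for h
  proof -
    have "2 * (Re (cinner h z) - Re (f h)) = 0"
    proof (rule quadratic_nonneg_imp_linear_zero[of "(norm h)\<^sup>2"])
      fix t :: real
      have "J (t *\<^sub>R h + z) - J z = t\<^sup>2 * (norm h)\<^sup>2 + t * (2 * (Re (cinner h z) - Re (f h)))"
        unfolding J_def norm_add_square f.add f.scaleR cinner.scaleR_left
        by (simp add: power_mult_distrib algebra_simps)
      then show "0 \<le> t\<^sup>2 * (norm h)\<^sup>2 + t * (2 * (Re (cinner h z) - Re (f h)))"
        using min[of "t *\<^sub>R h + z"] by linarith
    qed simp
    then show ?thesis by simp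
  qed
  \<comment> \<open>Real parts at h and at ih together determine the complex value.\<close>
  have "f h = cinner h z" for h
    using Re[of h] Re[of "\<i> *\<^sub>C h"] by (simp add: hom cinner_scaleC_left complex_eq_iff)
  then show ?thesis by blast
qed

section \<open>Closure properties of the complex-linear operators\<close>

lemma bounded_opsD: "a \<in> bounded_ops \<Longrightarrow> blinfun_apply a (c *\<^sub>C x) = c *\<^sub>C blinfun_apply a x"
  by (simp add: bounded_ops_def)

lemma zero_in_bounded_ops [simp]: "0 \<in> bounded_ops"
  by (simp add: bounded_ops_def)

lemma id_in_bounded_ops [simp]: "id_blinfun \<in> bounded_ops"
  by (simp add: bounded_ops_def)

lemma bounded_ops_add: "a \<in> bounded_ops \<Longrightarrow> b \<in> bounded_ops \<Longrightarrow> a + b \<in> bounded_ops"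
  by (simp add: bounded_ops_def blinfun.add_left scaleC_add_right)

lemma bounded_ops_scaleR: "a \<in> bounded_ops \<Longrightarrow> r *\<^sub>R a \<in> bounded_ops"
  by (simp add: bounded_ops_def blinfun.scaleR_left scaleR_scaleC scaleC_scaleC mult.commute)

lemma op_scaleC_apply [simp]: "blinfun_apply (op_scaleC c a) x = c *\<^sub>C blinfun_apply a x"
  by transfer simp

lemma bounded_ops_scaleC: "a \<in> bounded_ops \<Longrightarrow> op_scaleC c a \<in> bounded_ops"
  by (simp add: bounded_ops_def scaleC_scaleC mult.commute)

lemma bounded_ops_compose: "a \<in> bounded_ops \<Longrightarrow> b \<in> bounded_ops \<Longrightarrow> a o\<^sub>L b \<in> bounded_ops"
  by (simp add: bounded_ops_def)

lemma bounded_ops_sum: "(\<And>i. i \<in> I \<Longrightarrow> f i \<in> bounded_ops) \<Longrightarrow> sum f I \<in> bounded_ops"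
  by (induction I rule: infinite_finite_induct) (auto intro: bounded_ops_add)

lemma bounded_ops_LIMSEQ:
  assumes "\<And>n. s n \<in> bounded_ops" and "s \<longlonglongrightarrow> a"
  shows "a \<in> bounded_ops"
proof -
  have ap: "(\<lambda>n. blinfun_apply (s n) x) \<longlonglongrightarrow> blinfun_apply a x" for x
    by (intro tendsto_intros assms(2))
  have "blinfun_apply a (c *\<^sub>C x) = c *\<^sub>C blinfun_apply a x" for c x
  proof (rule LIMSEQ_unique)
    show "(\<lambda>n. blinfun_apply (s n) (c *\<^sub>C x)) \<longlonglongrightarrow> blinfun_apply a (c *\<^sub>C x)" by (rule ap)
    show "(\<lambda>n. blinfun_apply (s n) (c *\<^sub>C x)) \<longlonglongrightarrow> c *\<^sub>C blinfun_apply a x"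
      using bounded_linear.tendsto[OF bounded_linear_scaleC ap[of x], of c]
      by (simp add: bounded_opsD[OF assms(1)])
  qed
  then show ?thesis by (simp add: bounded_ops_def)
qed

text \<open>For fixed y the functional x -> <a x, y> is represented by a vector g y. Since inner
  products determine vectors, g is linear; boundedness is Cauchy-Schwarz at
  \<open>g x\<close>.\<close>

lemma adjoint_exists:
  fixes a :: "'h::complex_hilbert_space op"
  assumes "a \<in> bounded_ops"
  shows "\<exists>b. b \<in> bounded_ops \<and> (\<forall>x y. cinner (blinfun_apply a x) y = cinner x (blinfun_apply b y))"
proof -
  have "\<exists>z. \<forall>x. cinner (blinfun_apply a x) y = cinner x z" for y
    by (rule riesz_representation)
       (auto simp: bounded_opsD[OF assms] cinner_scaleC_left
         intro!: bounded_linear_compose[OF cinner.bounded_linear_left blinfun.bounded_linear_right])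
  then obtain g where g: "\<And>x y. cinner (blinfun_apply a x) y = cinner x (g y)" by metis
  have "bounded_linear g"
  proof (rule bounded_linear_intro[where K = "norm a"])
    show "g (x + y) = g x + g y" for x y
      by (rule cinner_ext) (simp add: g[symmetric] cinner_add_right)
    show "g (r *\<^sub>R x) = r *\<^sub>R g x" for r x
      by (rule cinner_ext) (simp add: g[symmetric] cinner.scaleR_right)
    show "norm (g x) \<le> norm x * norm a" for x
    proof (cases "g x = 0")
      case False
      have "(norm (g x))\<^sup>2 = cmod (cinner (blinfun_apply a (g x)) x)"
        by (simp add: g cinner_self norm_power)
      also have "\<dots> \<le> norm (blinfun_apply a (g x)) * norm x" by (rule cauchy_schwarz)
      also have "\<dots> \<le> norm a * norm (g x) * norm x"
        by (intro mult_right_mono norm_blinfun) simp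
      finally show ?thesis using False by (simp add: power2_eq_square mult.commute mult.left_commute)
    qed simp
  qed
  moreover have "g (c *\<^sub>C x) = c *\<^sub>C g x" for c x
    by (rule cinner_ext) (simp add: g[symmetric] cinner_scaleC_right)
  ultimately show ?thesis
    by (intro exI[of _ "Blinfun g"]) (auto simp: bounded_ops_def bounded_linear_Blinfun_apply g)
qed

lemma adj_unique:
  assumes "b \<in> bounded_ops"
    and "\<And>x y. cinner (blinfun_apply a x) y = cinner x (blinfun_apply b y)"
  shows "adj a = b"
  unfolding adj_def
proof (rule the_equality)
  fix c :: "'a op"
  assume "c \<in> bounded_ops \<and> (\<forall>x y. cinner (blinfun_apply a x) y = cinner x (blinfun_apply c y))"
  with assms(2) show "c = b" by (intro blinfun_eqI cinner_ext) metis
qed (use assms in auto)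

context
  fixes a :: "'h::complex_hilbert_space op"
  assumes a: "a \<in> bounded_ops"
begin

lemma adj_in_bounded_ops: "adj a \<in> bounded_ops"
  using adjoint_exists[OF a] adj_unique by blast

lemma cinner_adj_right: "cinner x (blinfun_apply (adj a) y) = cinner (blinfun_apply a x) y"
  using adjoint_exists[OF a] adj_unique by metis

lemma cinner_adj_left: "cinner (blinfun_apply (adj a) x) y = cinner x (blinfun_apply a y)"
  by (metis cinner_commute cinner_adj_right)

lemma norm_adj_le: "norm (adj a) \<le> norm a"
proof (rule norm_blinfun_bound)
  fix x
  let ?y = "blinfun_apply (adj a) x"
  show "norm ?y \<le> norm a * norm x"
  proof (cases "?y = 0")
    case False
    have "(norm ?y)\<^sup>2 = cmod (cinner (blinfun_apply a ?y) x)"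
      unfolding cinner_adj_right[symmetric] by (simp add: cinner_self norm_power)
    also have "\<dots> \<le> norm (blinfun_apply a ?y) * norm x" by (rule cauchy_schwarz)
    also have "\<dots> \<le> norm a * norm ?y * norm x"
      by (intro mult_right_mono norm_blinfun) simp
    finally show ?thesis using False by (simp add: power2_eq_square mult.commute mult.left_commute)
  qed simp
qed simp

end


section \<open>Compact operators\<close>

text \<open>A sequence in the closure is shadowed by one in S at distance below 1/(n+1), and the two
  converge along the same subsequences. Compactness of an operator can thus be tested on images of
  bounded sequences.\<close>

lemma compact_closure_if_sequences:
  fixes S :: "'a::real_normed_vector set"
  assumes sub: "\<And>g :: nat \<Rightarrow> 'a. (\<And>n. g n \<in> S) \<Longrightarrow> \<exists>r l. strict_mono r \<and> (\<lambda>n. g (r n)) \<longlonglongrightarrow> l"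
  shows "compact (closure S)"
  unfolding compact_eq_seq_compact_metric seq_compact_def
proof (intro allI impI)
  fix f :: "nat \<Rightarrow> 'a" assume f: "\<forall>n. f n \<in> closure S"
  have "\<exists>y\<in>S. dist y (f n) < 1 / real (Suc n)" for n
    using f[rule_format, of n] unfolding closure_approachable by simp
  then obtain g where g: "\<And>n. g n \<in> S" "\<And>n. dist (g n) (f n) < 1 / real (Suc n)" by metis
  obtain r l where r: "strict_mono r" and l: "(\<lambda>n. g (r n)) \<longlonglongrightarrow> l"
    using sub[of g] g(1) by blast
  have "(\<lambda>n. f n - g n) \<longlonglongrightarrow> 0"
    by (rule LIMSEQ_norm_0) (use g(2) in \<open>simp add: dist_norm norm_minus_commute\<close>)
  then have "(\<lambda>n. f (r n) - g (r n)) \<longlonglongrightarrow> 0"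
    using LIMSEQ_subseq_LIMSEQ[OF _ r] by (force simp: o_def)
  then have "(\<lambda>n. f (r n)) \<longlonglongrightarrow> l"
    by (rule Lim_transform[OF l])
  moreover have "l \<in> closure S"
    unfolding closure_sequential using l g(1) by (intro exI[of _ "\<lambda>n. g (r n)"]) auto
  ultimately show "\<exists>l\<in>closure S. \<exists>r. strict_mono r \<and> (f \<circ> r) \<longlonglongrightarrow> l"
    using r by (auto simp: o_def)
qed

lemma compact_ops_bounded: "a \<in> compact_ops \<Longrightarrow> a \<in> bounded_ops"
  by (simp add: compact_ops_def)

lemma compact_ops_subseq:
  fixes s :: "nat \<Rightarrow> 'h::complex_hilbert_space"
  assumes a: "a \<in> compact_ops" and s: "\<And>n. norm (s n) \<le> B"
  obtains r l where "strict_mono (r :: nat \<Rightarrow> nat)" "(\<lambda>n. blinfun_apply a (s (r n))) \<longlonglongrightarrow> l"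
proof -
  define C where "C = \<bar>B\<bar> + 1"
  have C: "C > 0" "norm (s n) \<le> C" for n
    using s[of n] by (simp_all add: C_def)
  define t where "t n = (1 / C) *\<^sub>R s n" for n
  have st: "s n = C *\<^sub>R t n" for n using C by (simp add: t_def)
  have "compact (closure (blinfun_apply a ` cball 0 1))" using a by (simp add: compact_ops_def)
  moreover have "\<forall>n. (blinfun_apply a \<circ> t) n \<in> closure (blinfun_apply a ` cball 0 1)"
    unfolding o_def using C
    by (intro allI subsetD[OF closure_subset] imageI) (simp add: t_def)
  ultimately obtain r l where r: "strict_mono r" and "((blinfun_apply a \<circ> t) \<circ> r) \<longlonglongrightarrow> l"
    unfolding compact_def by blast
  then have l: "(\<lambda>n. blinfun_apply a (t (r n))) \<longlonglongrightarrow> l" by (simp add: o_def)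
  have "(\<lambda>n. C *\<^sub>R blinfun_apply a (t (r n))) \<longlonglongrightarrow> C *\<^sub>R l"
    by (intro tendsto_intros l)
  then show ?thesis using r by (intro that) (simp_all add: st blinfun.scaleR_right)
qed

lemma compact_opsI:
  fixes a :: "'h::complex_hilbert_space op"
  assumes "a \<in> bounded_ops"
    and "\<And>s :: nat \<Rightarrow> 'h. (\<And>n. norm (s n) \<le> 1) \<Longrightarrow>
      \<exists>r l. strict_mono r \<and> (\<lambda>n. blinfun_apply a (s (r n))) \<longlonglongrightarrow> l"
  shows "a \<in> compact_ops"
proof -
  have "compact (closure (blinfun_apply a ` cball 0 1))"
  proof (rule compact_closure_if_sequences)
    fix g assume "\<And>n::nat. g n \<in> blinfun_apply a ` cball 0 1"
    then have "\<forall>n. \<exists>x. norm x \<le> 1 \<and> g n = blinfun_apply a x" by (meson imageE mem_cball_0)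
    then obtain s where "\<And>n. norm (s n) \<le> 1" "\<And>n. g n = blinfun_apply a (s n)" by metis
    then show "\<exists>r l. strict_mono r \<and> (\<lambda>n. g (r n)) \<longlonglongrightarrow> l" using assms(2)[of s] by simp
  qed
  then show ?thesis using assms(1) by (simp add: compact_ops_def)
qed

lemma compact_ops_add:
  assumes a: "a \<in> compact_ops" and b: "b \<in> compact_ops"
  shows "a + b \<in> compact_ops"
proof (rule compact_opsI)
  show "a + b \<in> bounded_ops" using assms by (simp add: bounded_ops_add compact_ops_bounded)
  fix s :: "nat \<Rightarrow> 'a" assume s: "\<And>n. norm (s n) \<le> 1"
  obtain r l where r: "strict_mono r" "(\<lambda>n. blinfun_apply a (s (r n))) \<longlonglongrightarrow> l"
    by (rule compact_ops_subseq[OF a s])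
  obtain r' l' where r': "strict_mono r'" "(\<lambda>n. blinfun_apply b (s (r (r' n)))) \<longlonglongrightarrow> l'"
    by (rule compact_ops_subseq[OF b, of "\<lambda>n. s (r n)" 1]) (rule s)
  have "(\<lambda>n. blinfun_apply a (s (r (r' n)))) \<longlonglongrightarrow> l"
    using LIMSEQ_subseq_LIMSEQ[OF r(2) r'(1)] by (simp add: o_def)
  then have "(\<lambda>n. blinfun_apply (a + b) (s ((r \<circ> r') n))) \<longlonglongrightarrow> l + l'"
    using r'(2) by (simp add: blinfun.add_left tendsto_add)
  then show "\<exists>r l. strict_mono r \<and> (\<lambda>n. blinfun_apply (a + b) (s (r n))) \<longlonglongrightarrow> l"
    using strict_mono_o[OF r(1) r'(1)] by blast
qed

lemma compact_ops_compose_left: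
  assumes a: "a \<in> compact_ops" and b: "b \<in> bounded_ops"
  shows "b o\<^sub>L a \<in> compact_ops"
proof (rule compact_opsI)
  show "b o\<^sub>L a \<in> bounded_ops" using assms by (simp add: bounded_ops_compose compact_ops_bounded)
  fix s :: "nat \<Rightarrow> 'a" assume s: "\<And>n. norm (s n) \<le> 1"
  obtain r l where r: "strict_mono r" "(\<lambda>n. blinfun_apply a (s (r n))) \<longlonglongrightarrow> l"
    by (rule compact_ops_subseq[OF a s])
  have "(\<lambda>n. blinfun_apply (b o\<^sub>L a) (s (r n))) \<longlonglongrightarrow> blinfun_apply b l"
    using blinfun.tendsto[OF tendsto_const r(2)] by simp
  then show "\<exists>r l. strict_mono r \<and> (\<lambda>n. blinfun_apply (b o\<^sub>L a) (s (r n))) \<longlonglongrightarrow> l"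
    using r(1) by blast
qed

lemma compact_ops_compose_right:
  assumes a: "a \<in> compact_ops" and b: "b \<in> bounded_ops"
  shows "a o\<^sub>L b \<in> compact_ops"
proof (rule compact_opsI)
  show "a o\<^sub>L b \<in> bounded_ops" using assms by (simp add: bounded_ops_compose compact_ops_bounded)
  fix s :: "nat \<Rightarrow> 'a" assume s: "\<And>n. norm (s n) \<le> 1"
  have "norm (blinfun_apply b (s n)) \<le> norm b" for n
    using norm_blinfun[of b "s n"] s[of n] by (meson mult_left_le norm_ge_zero order_trans)
  then obtain r l where "strict_mono r" "(\<lambda>n. blinfun_apply a (blinfun_apply b (s (r n)))) \<longlonglongrightarrow> l"
    by (rule compact_ops_subseq[OF a, of "\<lambda>n. blinfun_apply b (s n)"])
  then show "\<exists>r l. strict_mono r \<and> (\<lambda>n. blinfun_apply (a o\<^sub>L b) (s (r n))) \<longlonglongrightarrow> l"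
    by auto
qed

lemma op_scaleC_eq_compose: "op_scaleC c a = op_scaleC c id_blinfun o\<^sub>L a"
  by (rule blinfun_eqI) simp

lemma compact_ops_scaleC: "a \<in> compact_ops \<Longrightarrow> op_scaleC c a \<in> compact_ops"
  by (subst op_scaleC_eq_compose) (simp add: compact_ops_compose_left bounded_ops_scaleC)

lemma zero_in_compact_ops [simp]: "0 \<in> compact_ops"
  by (rule compact_opsI) (auto intro!: exI[of _ id] simp: strict_mono_def)

lemma op_scaleC_minus_one: "op_scaleC (- 1) a = - a"
  by (rule blinfun_eqI) (simp add: blinfun.minus_left cvec.scale_minus_left scaleC_one)

lemma compact_ops_diff: "a \<in> compact_ops \<Longrightarrow> b \<in> compact_ops \<Longrightarrow> a - b \<in> compact_ops"
  using compact_ops_add[of a "- b"] compact_ops_scaleC[of b "- 1"] by (simp add: op_scaleC_minus_one)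

text \<open>Schauder's theorem: \<open>\<parallel>a\<^sup>* x\<parallel>\<^sup>2 = \<langle>a a\<^sup>* x, x\<rangle>\<close>, so convergence of \<open>a a\<^sup>* x\<^sub>n\<close> forces
  convergence of \<open>a\<^sup>* x\<^sub>n\<close>.\<close>

lemma compact_ops_adj:
  assumes a: "a \<in> compact_ops"
  shows "adj a \<in> compact_ops"
proof (rule compact_opsI)
  note ab = compact_ops_bounded[OF a]
  show "adj a \<in> bounded_ops" by (rule adj_in_bounded_ops[OF ab])
  fix s :: "nat \<Rightarrow> 'a" assume s: "\<And>n. norm (s n) \<le> 1"
  obtain r l where r: "strict_mono r" "(\<lambda>n. blinfun_apply (a o\<^sub>L adj a) (s (r n))) \<longlonglongrightarrow> l"
    by (rule compact_ops_subseq[OF compact_ops_compose_right[OF a adj_in_bounded_ops[OF ab]] s])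
  let ?t = "\<lambda>n. blinfun_apply (a o\<^sub>L adj a) (s (r n))"
  have bd: "(norm (blinfun_apply (adj a) (s (r m)) - blinfun_apply (adj a) (s (r n))))\<^sup>2
      \<le> norm (?t m - ?t n) * 2" for m n
  proof -
    let ?d = "s (r m) - s (r n)"
    have "(norm (blinfun_apply (adj a) ?d))\<^sup>2 = cmod (cinner (blinfun_apply a (blinfun_apply (adj a) ?d)) ?d)"
      by (simp add: cinner_adj_right[OF ab, symmetric] cinner_self norm_power)
    also have "\<dots> \<le> norm (blinfun_apply a (blinfun_apply (adj a) ?d)) * norm ?d"
      by (rule cauchy_schwarz)
    also have "\<dots> \<le> norm (blinfun_apply a (blinfun_apply (adj a) ?d)) * 2"
      using norm_triangle_ineq4[of "s (r m)" "s (r n)"] s[of "r m"] s[of "r n"]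
      by (intro mult_left_mono) auto
    finally show ?thesis by (simp add: blinfun.diff_right)
  qed
  have "Cauchy (\<lambda>n. blinfun_apply (adj a) (s (r n)))"
  proof (rule metric_CauchyI)
    fix e :: real assume "0 < e"
    then obtain M where M: "\<And>m n. m \<ge> M \<Longrightarrow> n \<ge> M \<Longrightarrow> norm (?t m - ?t n) < e\<^sup>2 / 2"
      using LIMSEQ_imp_Cauchy[OF r(2)] unfolding Cauchy_iff
      by (metis half_gt_zero zero_less_power)
    have "dist (blinfun_apply (adj a) (s (r m))) (blinfun_apply (adj a) (s (r n))) < e"
      if "M \<le> m" "M \<le> n" for m n
    proof -
      have "(norm (blinfun_apply (adj a) (s (r m)) - blinfun_apply (adj a) (s (r n))))\<^sup>2 < e\<^sup>2"
        using bd[of m n] M[OF that] by linarith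
      then show ?thesis using \<open>0 < e\<close> by (simp add: dist_norm power_less_imp_less_base)
    qed
    then show "\<exists>M. \<forall>m\<ge>M. \<forall>n\<ge>M. dist (blinfun_apply (adj a) (s (r m))) (blinfun_apply (adj a) (s (r n))) < e"
      by blast
  qed
  then show "\<exists>r l. strict_mono r \<and> (\<lambda>n. blinfun_apply (adj a) (s (r n))) \<longlonglongrightarrow> l"
    using r(1) Cauchy_convergent convergent_def by blast
qed

text \<open>Total boundedness survives norm limits: if |s n - a| < e/3, a finite e/3-net for the
  image of the unit ball under \<open>s n\<close> is an e-net for its image under
  \<open>a\<close>.\<close>

lemma compact_ops_LIMSEQ:
  fixes s :: "nat \<Rightarrow> 'h::complex_hilbert_space op"
  assumes s: "\<And>n. s n \<in> compact_ops" and lim: "s \<longlonglongrightarrow> a"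
  shows "a \<in> compact_ops"
proof -
  have "\<exists>k. finite k \<and> closure (blinfun_apply a ` cball 0 1) \<subseteq> (\<Union>x\<in>k. ball x e)" if "0 < e" for e
  proof -
    obtain n where n: "norm (s n - a) < e / 3"
      using LIMSEQ_D[OF lim, of "e / 3"] \<open>0 < e\<close> by auto
    have "compact (closure (blinfun_apply (s n) ` cball 0 1))"
      using s by (simp add: compact_ops_def)
    then obtain k where k: "finite k"
      "closure (blinfun_apply (s n) ` cball 0 1) \<subseteq> (\<Union>x\<in>k. ball x (e / 3))"
      unfolding compact_eq_totally_bounded using \<open>0 < e\<close> by (meson divide_pos_pos zero_less_numeral)
    have "closure (blinfun_apply a ` cball 0 1) \<subseteq> (\<Union>x\<in>k. ball x e)"
    proof
      fix y assume "y \<in> closure (blinfun_apply a ` cball 0 1)"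
      then obtain x where x: "norm x \<le> 1" "dist (blinfun_apply a x) y < e / 3"
        using \<open>0 < e\<close> by (auto simp: closure_approachable dest!: spec[of _ "e / 3"])
      have "blinfun_apply (s n) x \<in> closure (blinfun_apply (s n) ` cball 0 1)"
        using x(1) by (intro subsetD[OF closure_subset] imageI) simp
      then obtain z where z: "z \<in> k" "dist z (blinfun_apply (s n) x) < e / 3"
        using k(2) by auto
      have "dist (blinfun_apply (s n) x) (blinfun_apply a x) \<le> norm (s n - a) * norm x"
        using norm_blinfun[of "s n - a" x] by (simp add: dist_norm blinfun.diff_left)
      also have "\<dots> \<le> norm (s n - a) * 1"
        using x(1) by (intro mult_left_mono) auto
      finally have "dist (blinfun_apply (s n) x) (blinfun_apply a x) < e / 3" using n by simp
      then have "dist z y < e" using x(2) z(2) by metric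
      then show "y \<in> (\<Union>x\<in>k. ball x e)" using z(1) by auto
    qed
    then show ?thesis using k(1) by blast
  qed
  then have "compact (closure (blinfun_apply a ` cball 0 1))"
    by (simp add: compact_eq_totally_bounded complete_eq_closed)
  moreover have "a \<in> bounded_ops"
    using bounded_ops_LIMSEQ[OF _ lim] s compact_ops_bounded by blast
  ultimately show ?thesis by (simp add: compact_ops_def)
qed


section \<open>Eigensystems\<close>

text \<open>Bessel's inequality taken as the defining property. It admits zero vectors and is stable
  under contractions, which is what the maximum principle needs.\<close>

definition bessel :: "(nat \<Rightarrow> 'h::complex_hilbert_space) \<Rightarrow> bool" where
  "bessel e \<longleftrightarrow> (\<forall>x n. (\<Sum>i<n. (cmod (cinner x (e i)))\<^sup>2) \<le> (norm x)\<^sup>2)"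

lemma norm_sum_orthogonal:
  fixes e :: "nat \<Rightarrow> 'h::complex_hilbert_space"
  assumes orth: "\<And>i j. i \<noteq> j \<Longrightarrow> cinner (e i) (e j) = 0" and "finite I"
  shows "(norm (\<Sum>i\<in>I. c i *\<^sub>C e i))\<^sup>2 = (\<Sum>i\<in>I. (cmod (c i))\<^sup>2 * (norm (e i))\<^sup>2)"
  using \<open>finite I\<close>
proof (induction rule: finite_induct)
  case (insert j I)
  have "cinner (c j *\<^sub>C e j) (c i *\<^sub>C e i) = 0" if "i \<in> I" for i
    using orth[of j i] that insert.hyps by (auto simp: cinner_scaleC_left cinner_scaleC_right)
  then have "cinner (c j *\<^sub>C e j) (\<Sum>i\<in>I. c i *\<^sub>C e i) = 0"
    by (simp add: cinner.sum_right)
  with insert show ?case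
    by (simp add: norm_add_square norm_scaleC power_mult_distrib)
qed simp

text \<open>With S the sum of squared coefficients and v the partial expansion, S = <x, v> <= |x|
  |v| while |v|^2 <= S.\<close>

lemma bessel_orthogonal:
  fixes e :: "nat \<Rightarrow> 'h::complex_hilbert_space"
  assumes orth: "\<And>i j. i \<noteq> j \<Longrightarrow> cinner (e i) (e j) = 0" and le: "\<And>i. norm (e i) \<le> 1"
  shows "bessel e"
  unfolding bessel_def
proof (intro allI)
  fix x n
  define c where "c i = cinner x (e i)" for i
  define S where "S = (\<Sum>i<n. (cmod (c i))\<^sup>2)"
  define v where "v = (\<Sum>i<n. c i *\<^sub>C e i)"
  have "0 \<le> S" unfolding S_def by (intro sum_nonneg) simp
  have "(norm v)\<^sup>2 = (\<Sum>i<n. (cmod (c i))\<^sup>2 * (norm (e i))\<^sup>2)"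
    unfolding v_def by (rule norm_sum_orthogonal[OF orth]) auto
  also have "\<dots> \<le> S"
    unfolding S_def by (intro sum_mono mult_left_le) (use le in \<open>auto simp: power_le_one\<close>)
  finally have v: "(norm v)\<^sup>2 \<le> S" .
  have "cinner x v = (\<Sum>i<n. cnj (c i) * c i)"
    unfolding v_def by (simp add: cinner.sum_right cinner_scaleC_right c_def)
  also have "\<dots> = complex_of_real S"
    unfolding S_def of_real_sum by (intro sum.cong refl) (subst complex_norm_square, simp add: mult.commute)
  finally have "S = cmod (cinner x v)" using \<open>0 \<le> S\<close> by simp
  also have "\<dots> \<le> norm x * norm v" by (rule cauchy_schwarz)
  finally have "S\<^sup>2 \<le> (norm x)\<^sup>2 * (norm v)\<^sup>2"
    using \<open>0 \<le> S\<close> by (metis power_mono power_mult_distrib)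
  also have "\<dots> \<le> (norm x)\<^sup>2 * S" by (intro mult_left_mono v) simp
  finally have "S \<le> (norm x)\<^sup>2"
    using \<open>0 \<le> S\<close> by (cases "S = 0") (auto simp: power2_eq_square)
  then show "(\<Sum>i<n. (cmod (cinner x (e i)))\<^sup>2) \<le> (norm x)\<^sup>2"
    by (simp add: S_def c_def)
qed

lemma bessel_norm_le:
  fixes e :: "nat \<Rightarrow> 'h::complex_hilbert_space"
  assumes "bessel e" shows "norm (e i) \<le> 1"
proof (cases "e i = 0")
  case False
  have "((norm (e i))\<^sup>2)\<^sup>2 = (cmod (cinner (e i) (e i)))\<^sup>2" by (simp add: cinner_self norm_power)
  also have "\<dots> \<le> (\<Sum>j<Suc i. (cmod (cinner (e i) (e j)))\<^sup>2)"
    by (rule member_le_sum[of i]) auto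
  also have "\<dots> \<le> (norm (e i))\<^sup>2" using assms unfolding bessel_def by blast
  finally have "(norm (e i))\<^sup>2 * (norm (e i))\<^sup>2 \<le> 1 * (norm (e i))\<^sup>2"
    by (simp only: power2_eq_square[of "(norm (e i))\<^sup>2"] mult_1)
  then have "(norm (e i))\<^sup>2 \<le> 1"
    using False by (subst (asm) mult_le_cancel_right) auto
  then show ?thesis by (simp add: power2_le_iff_abs_le abs_square_le_1)
qed simp

lemma bessel_compose:
  assumes "bessel g" and b: "b \<in> bounded_ops" "norm b \<le> 1"
  shows "bessel (\<lambda>i. blinfun_apply b (g i))"
  unfolding bessel_def
proof (intro allI)
  fix x n
  have "(\<Sum>i<n. (cmod (cinner x (blinfun_apply b (g i))))\<^sup>2) = (\<Sum>i<n. (cmod (cinner (blinfun_apply (adj b) x) (g i)))\<^sup>2)"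
    by (simp add: cinner_adj_left[OF b(1)])
  also have "\<dots> \<le> (norm (blinfun_apply (adj b) x))\<^sup>2" using assms(1) unfolding bessel_def by blast
  also have "\<dots> \<le> (norm x)\<^sup>2"
  proof (rule power_mono)
    have "norm (blinfun_apply (adj b) x) \<le> norm (adj b) * norm x" by (rule norm_blinfun)
    also have "\<dots> \<le> 1 * norm x"
      using norm_adj_le[OF b(1)] b(2) by (intro mult_right_mono) auto
    finally show "norm (blinfun_apply (adj b) x) \<le> norm x" by simp
  qed simp
  finally show "(\<Sum>i<n. (cmod (cinner x (blinfun_apply b (g i))))\<^sup>2) \<le> (norm x)\<^sup>2" .
qed

section \<open>Orthonormal expansions and diagonal operators\<close>

definition orthonormal :: "(nat \<Rightarrow> 'h::complex_hilbert_space) \<Rightarrow> bool" where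
  "orthonormal e \<longleftrightarrow> (\<forall>i j. cinner (e i) (e j) = (if i = j then 1 else 0))"

lemma orthonormal_cinner: "orthonormal e \<Longrightarrow> cinner (e i) (e j) = (if i = j then 1 else 0)"
  by (simp add: orthonormal_def)

lemma orthonormal_norm: "orthonormal e \<Longrightarrow> norm (e i) = 1"
  by (simp add: norm_eq_sqrt_cinner orthonormal_cinner)

lemma orthonormal_bessel: "orthonormal e \<Longrightarrow> bessel e"
  by (rule bessel_orthogonal) (simp_all add: orthonormal_cinner orthonormal_norm)

lemma norm_sum_orthonormal:
  assumes "orthonormal e" "finite I"
  shows "(norm (\<Sum>i\<in>I. c i *\<^sub>C e i))\<^sup>2 = (\<Sum>i\<in>I. (cmod (c i))\<^sup>2)"
  using norm_sum_orthogonal[of e I c] assms by (simp add: orthonormal_cinner orthonormal_norm)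

lemma cinner_sum_orthonormal:
  assumes "orthonormal e" "finite I"
  shows "cinner (\<Sum>i\<in>I. c i *\<^sub>C e i) (e j) = (if j \<in> I then c j else 0)"
  using assms by (simp add: cinner.sum_left cinner_scaleC_left orthonormal_cinner if_distrib cong: if_cong)

text \<open>Square summability of the coefficients makes the partial sums Cauchy. The sequence may
  be incomplete, so the component y orthogonal to it is kept; an operator known on each e_i and on y
  is then known on x by continuity.\<close>

lemma orthonormal_expansion:
  fixes x :: "'h::complex_hilbert_space"
  assumes e: "orthonormal e"
  obtains y where "\<And>i. cinner y (e i) = 0"
    "(\<lambda>n. (\<Sum>i<n. cinner x (e i) *\<^sub>C e i) + y) \<longlonglongrightarrow> x"
proof -
  define c where "c i = cinner x (e i)" for i
  define P where "P n = (\<Sum>i<n. c i *\<^sub>C e i)" for n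
  have "summable (\<lambda>i. (cmod (c i))\<^sup>2)"
    using orthonormal_bessel[OF e] unfolding bessel_def c_def
    by (intro summableI_nonneg_bounded[where x = "(norm x)\<^sup>2"]) auto
  then have C: "Cauchy (\<lambda>n. \<Sum>i<n. (cmod (c i))\<^sup>2)"
    by (simp add: summable_iff_convergent Cauchy_convergent_iff)
  have diff: "(norm (P n - P m))\<^sup>2 = (\<Sum>i<n. (cmod (c i))\<^sup>2) - (\<Sum>i<m. (cmod (c i))\<^sup>2)" if "m \<le> n" for m n
  proof -
    have "P n - P m = (\<Sum>i\<in>{m..<n}. c i *\<^sub>C e i)"
      unfolding P_def using that sum_diff_nat_ivl[of 0 m n "\<lambda>i. c i *\<^sub>C e i"] by (simp add: lessThan_atLeast0)
    moreover have "(\<Sum>i\<in>{m..<n}. (cmod (c i))\<^sup>2) = (\<Sum>i<n. (cmod (c i))\<^sup>2) - (\<Sum>i<m. (cmod (c i))\<^sup>2)"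
      using that sum_diff_nat_ivl[of 0 m n "\<lambda>i. (cmod (c i))\<^sup>2"] by (simp add: lessThan_atLeast0)
    ultimately show ?thesis using norm_sum_orthonormal[OF e, of "{m..<n}" c] by simp
  qed
  have "Cauchy P"
  proof (rule metric_CauchyI)
    fix r :: real assume "0 < r"
    then obtain M where M: "\<And>m n. M \<le> m \<Longrightarrow> M \<le> n \<Longrightarrow>
        norm ((\<Sum>i<n. (cmod (c i))\<^sup>2) - (\<Sum>i<m. (cmod (c i))\<^sup>2)) < r\<^sup>2"
      using CauchyD[OF C, of "r\<^sup>2"] by auto
    have *: "norm (P n - P m) < r" if "M \<le> m" "m \<le> n" for m n
    proof -
      have "(norm (P n - P m))\<^sup>2 < r\<^sup>2" using M[of m n] that diff[of m n] by simp
      then show ?thesis using \<open>0 < r\<close> by (simp add: power_less_imp_less_base)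
    qed
    then show "\<exists>M. \<forall>m\<ge>M. \<forall>n\<ge>M. dist (P m) (P n) < r"
      by (intro exI[of _ M]) (metis dist_commute dist_norm nle_le)
  qed
  then obtain z where z: "P \<longlonglongrightarrow> z" using Cauchy_convergent convergent_def by blast
  have "cinner (x - z) (e j) = 0" for j
  proof -
    have "(\<lambda>n. cinner (P n) (e j)) \<longlonglongrightarrow> cinner z (e j)"
      by (intro cinner.tendsto z tendsto_const)
    moreover have "(\<lambda>n. cinner (P n) (e j)) \<longlonglongrightarrow> c j"
      by (rule tendsto_eventually, rule eventually_mono[OF eventually_gt_at_top[of j]])
         (simp add: P_def cinner_sum_orthonormal[OF e])
    ultimately have "cinner z (e j) = c j" using LIMSEQ_unique by blast
    then show ?thesis by (simp add: cinner.diff_left c_def)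
  qed
  moreover have "(\<lambda>n. P n + (x - z)) \<longlonglongrightarrow> z + (x - z)" by (intro tendsto_intros z)
  ultimately show ?thesis by (intro that[of "x - z"]) (simp_all add: P_def c_def)
qed

lemma blinfun_apply_sum_scaleC:
  assumes "a \<in> bounded_ops"
  shows "blinfun_apply a (\<Sum>i\<in>I. c i *\<^sub>C x i) = (\<Sum>i\<in>I. c i *\<^sub>C blinfun_apply a (x i))"
  by (simp add: blinfun.sum_right bounded_opsD[OF assms])

text \<open>Pythagoras on the partial expansions, then a limit. The extra scalar \<open>k\<close> is
  for polynomials with a constant term: they act on the orthogonal complement as a multiple of the
  identity.\<close>

lemma norm_diagonal_le:
  fixes a :: "'h::complex_hilbert_space op"
  assumes e: "orthonormal e" and a: "a \<in> bounded_ops"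
    and diag: "\<And>i. blinfun_apply a (e i) = m i *\<^sub>R e i" "\<And>i. \<bar>m i\<bar> \<le> B"
    and perp: "\<And>y. (\<And>i. cinner y (e i) = 0) \<Longrightarrow> blinfun_apply a y = k *\<^sub>R y" "\<bar>k\<bar> \<le> B"
  shows "norm a \<le> B"
proof (rule norm_blinfun_bound)
  show "0 \<le> B" using perp(2) by simp
  fix x
  obtain y where y: "\<And>i. cinner y (e i) = 0"
    and lim: "(\<lambda>n. (\<Sum>i<n. cinner x (e i) *\<^sub>C e i) + y) \<longlonglongrightarrow> x"
    using orthonormal_expansion[OF e] by blast
  define c where "c i = cinner x (e i)" for i
  have perp_sum: "cinner (\<Sum>i<n. d i *\<^sub>C e i) y = 0" for n d
    using y cinner_eq_zero_commute[of y] by (simp add: cinner.sum_left cinner_scaleC_left)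
  define z where "z n = (\<Sum>i<n. c i *\<^sub>C e i) + y" for n
  have zx: "z \<longlonglongrightarrow> x" using lim by (simp add: z_def[abs_def] c_def)
  have "norm (blinfun_apply a (z n)) \<le> B * norm (z n)" for n
  proof -
    have "blinfun_apply a (z n) = (\<Sum>i<n. (c i * complex_of_real (m i)) *\<^sub>C e i) + complex_of_real k *\<^sub>C y"
      using perp(1)[OF y] unfolding z_def blinfun.add_right
      by (simp add: blinfun_apply_sum_scaleC[OF a] diag(1) scaleR_scaleC scaleC_scaleC)
    then have "(norm (blinfun_apply a (z n)))\<^sup>2 = (\<Sum>i<n. (cmod (c i * complex_of_real (m i)))\<^sup>2) + (\<bar>k\<bar> * norm y)\<^sup>2"
      by (simp only: norm_add_square cinner_scaleC_right perp_sum norm_sum_orthonormal[OF e finite_lessThan] norm_scaleC) simp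
    also have "\<dots> \<le> (\<Sum>i<n. (B * cmod (c i))\<^sup>2) + (B * norm y)\<^sup>2"
    proof (intro add_mono sum_mono power_mono)
      show "cmod (c i * complex_of_real (m i)) \<le> B * cmod (c i)" for i
        using mult_right_mono[OF diag(2)[of i], of "cmod (c i)"] by (simp add: norm_mult mult.commute)
      show "\<bar>k\<bar> * norm y \<le> B * norm y" by (intro mult_right_mono perp(2)) simp
    qed auto
    also have "\<dots> = (B * norm (z n))\<^sup>2"
      unfolding z_def power_mult_distrib norm_add_square perp_sum norm_sum_orthonormal[OF e finite_lessThan]
      by (simp add: algebra_simps sum_distrib_left)
    finally show ?thesis
      by (rule power2_le_imp_le) (use \<open>0 \<le> B\<close> in simp)
  qed
  moreover have "(\<lambda>n. norm (blinfun_apply a (z n))) \<longlonglongrightarrow> norm (blinfun_apply a x)"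
    by (intro tendsto_intros zx)
  moreover have "(\<lambda>n. B * norm (z n)) \<longlonglongrightarrow> B * norm x"
    by (intro tendsto_intros zx)
  ultimately show "norm (blinfun_apply a x) \<le> B * norm x" by (intro LIMSEQ_le) auto
qed

text \<open>The decomposition a = sum of l_i <., e_i> e_i. Zero entries of \<open>l\<close> pad the
  finite-rank case, and the kernel of \<open>a\<close> may be larger than the part seen by
  \<open>e\<close>.\<close>

definition eigensystem :: "(nat \<Rightarrow> 'h) \<Rightarrow> (nat \<Rightarrow> real) \<Rightarrow> 'h::complex_hilbert_space op \<Rightarrow> bool" where
  "eigensystem e l a \<longleftrightarrow> a \<in> bounded_ops \<and> orthonormal e \<and> decseq l \<and> (\<forall>i. 0 \<le> l i) \<and> l \<longlonglongrightarrow> 0 \<and>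
     (\<forall>i. blinfun_apply a (e i) = l i *\<^sub>R e i) \<and>
     (\<forall>y. (\<forall>i. cinner y (e i) = 0) \<longrightarrow> blinfun_apply a y = 0)"

context
  fixes e :: "nat \<Rightarrow> 'h::complex_hilbert_space" and l a
  assumes ea: "eigensystem e l a"
begin

lemma eigensystem_orthonormal: "orthonormal e"
  and eigensystem_bounded_ops: "a \<in> bounded_ops"
  and eigensystem_decseq: "decseq l"
  and eigensystem_nonneg: "0 \<le> l i"
  and eigensystem_tendsto: "l \<longlonglongrightarrow> 0"
  and eigensystem_apply: "blinfun_apply a (e i) = l i *\<^sub>R e i"
  and eigensystem_perp: "(\<And>i. cinner y (e i) = 0) \<Longrightarrow> blinfun_apply a y = 0"
  using ea by (auto simp: eigensystem_def)

lemma eigensystem_le_norm: "l i \<le> norm a"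
  using norm_blinfun[of a "e i"] eigensystem_nonneg[of i]
  by (simp add: eigensystem_apply orthonormal_norm[OF eigensystem_orthonormal])

text \<open>On partial expansions a is explicit, and continuity does the rest. This coordinate form
  serves in place of self-adjointness.\<close>

lemma eigensystem_coeff: "cinner (blinfun_apply a x) (e j) = complex_of_real (l j) * cinner x (e j)"
proof -
  obtain y where y: "\<And>i. cinner y (e i) = 0"
    and lim: "(\<lambda>n. (\<Sum>i<n. cinner x (e i) *\<^sub>C e i) + y) \<longlonglongrightarrow> x"
    using orthonormal_expansion[OF eigensystem_orthonormal] by blast
  define z where "z n = (\<Sum>i<n. cinner x (e i) *\<^sub>C e i) + y" for n
  have zx: "z \<longlonglongrightarrow> x" using lim by (simp add: z_def[abs_def])
  have "cinner (blinfun_apply a (z n)) (e j) = complex_of_real (l j) * cinner (z n) (e j)" for n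
  proof -
    have "blinfun_apply a (z n) = (\<Sum>i<n. (cinner x (e i) * complex_of_real (l i)) *\<^sub>C e i)"
      using eigensystem_perp[OF y] unfolding z_def blinfun.add_right
      by (simp add: blinfun_apply_sum_scaleC[OF eigensystem_bounded_ops] eigensystem_apply scaleR_scaleC scaleC_scaleC)
    then show ?thesis unfolding z_def
      by (simp add: cinner_sum_orthonormal[OF eigensystem_orthonormal] cinner_add_left y)
  qed
  moreover have "(\<lambda>n. cinner (blinfun_apply a (z n)) (e j)) \<longlonglongrightarrow> cinner (blinfun_apply a x) (e j)"
    by (intro cinner.tendsto tendsto_intros zx)
  moreover have "(\<lambda>n. complex_of_real (l j) * cinner (z n) (e j)) \<longlonglongrightarrow> complex_of_real (l j) * cinner x (e j)"
    by (intro cinner.tendsto tendsto_intros zx)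
  ultimately show ?thesis using LIMSEQ_unique by force
qed

lemma eigensystem_finite:
  assumes "0 < t" shows "finite {i. l i = t}"
proof -
  obtain N where "\<And>n. n \<ge> N \<Longrightarrow> l n < t"
    using order_tendstoD(2)[OF eigensystem_tendsto assms] unfolding eventually_sequentially by blast
  then have "{i. l i = t} \<subseteq> {..<N}" by (auto simp: not_less[symmetric])
  then show ?thesis by (rule finite_subset) simp
qed

text \<open>An eigenvector x for t has zero coefficient wherever l_j differs from t. Its remainder
  after subtracting the other coefficients is orthogonal to every e_i, hence killed by a, yet also
  satisfies the eigenvalue equation for t > 0; so it vanishes.\<close>

lemma eigensystem_dim:
  assumes t: "0 < t"
  shows "cvec.dim {x. blinfun_apply a x = complex_of_real t *\<^sub>C x} = card {i. l i = t}"
proof -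
  define I where "I = {i. l i = t}"
  have fin: "finite I" using eigensystem_finite[OF t] by (simp add: I_def)
  note on = eigensystem_orthonormal
  have inj: "inj e"
    by (rule injI) (metis on orthonormal_cinner zero_neq_one)
  have sub: "e ` I \<subseteq> {x. blinfun_apply a x = complex_of_real t *\<^sub>C x}"
    by (auto simp: I_def eigensystem_apply scaleR_scaleC)
  have subsp: "cvec.subspace {x. blinfun_apply a x = complex_of_real t *\<^sub>C x}"
    by (rule cvec.subspaceI)
       (auto simp: blinfun.add_right scaleC_add_right bounded_opsD[OF eigensystem_bounded_ops]
         scaleC_scaleC mult.commute)
  have "x \<in> cvec.span (e ` I)" if x: "blinfun_apply a x = complex_of_real t *\<^sub>C x" for x
  proof -
    have c0: "cinner x (e j) = 0" if "j \<notin> I" for j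
      using eigensystem_coeff[of x j] that by (auto simp: x cinner_scaleC_left I_def)
    define w where "w = (\<Sum>i\<in>I. cinner x (e i) *\<^sub>C e i)"
    have ws: "w \<in> cvec.span (e ` I)"
      unfolding w_def by (intro cvec.span_sum cvec.span_scale cvec.span_base) auto
    then have "w \<in> {x. blinfun_apply a x = complex_of_real t *\<^sub>C x}"
      using cvec.span_minimal[OF sub subsp] by blast
    then have "blinfun_apply a (x - w) = complex_of_real t *\<^sub>C (x - w)"
      using x by (simp add: blinfun.diff_right cvec.scale_right_diff_distrib)
    moreover have "blinfun_apply a (x - w) = 0"
      by (rule eigensystem_perp) (simp add: w_def cinner.diff_left cinner_sum_orthonormal[OF on fin] c0)
    ultimately have "x = w" using t by simp
    then show ?thesis using ws by simp
  qed
  then have "{x. blinfun_apply a x = complex_of_real t *\<^sub>C x} = cvec.span (e ` I)"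
    using cvec.span_minimal[OF sub subsp] by blast
  moreover have "cvec.independent (e ` I)"
  proof (rule cvec.independent_if_scalars_zero)
    show "finite (e ` I)" using fin by simp
    fix f x assume f: "(\<Sum>x\<in>e ` I. f x *\<^sub>C x) = 0" and "x \<in> e ` I"
    then obtain j where j: "j \<in> I" "x = e j" by blast
    have "(\<Sum>i\<in>I. f (e i) *\<^sub>C e i) = 0"
      using f inj by (simp add: sum.reindex inj_on_subset[OF inj])
    then show "f x = 0"
      using cinner_sum_orthonormal[OF on fin, of "\<lambda>i. f (e i)" j] j by (simp add: cinner.zero_left)
  qed
  ultimately have "cvec.dim {x. blinfun_apply a x = complex_of_real t *\<^sub>C x} = card (e ` I)"
    using cvec.dim_span_eq_card_independent by metis
  then show ?thesis
    using inj_on_subset[OF inj, of I] by (simp add: card_image I_def)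
qed

lemma eigensystem_is_eigval_seq: "is_eigval_seq a l"
  unfolding is_eigval_seq_def
  using eigensystem_dim eigensystem_finite eigensystem_decseq eigensystem_nonneg by simp

end

text \<open>If m n = t exceeded l n, every occurrence of t in the decreasing sequence l would lie
  before n, where l and m agree. Then m would contain t strictly more often, although both
  multiplicities are the dimension of the same eigenspace.\<close>

lemma is_eigval_seq_le:
  assumes l: "is_eigval_seq a l" and m: "is_eigval_seq a m" and eq: "\<And>i. i < n \<Longrightarrow> l i = m i"
  shows "m n \<le> l n"
proof (rule ccontr)
  assume "\<not> m n \<le> l n"
  define t where "t = m n"
  have lt: "l n < t" using \<open>\<not> m n \<le> l n\<close> by (simp add: t_def)
  have t: "t > 0" using l lt unfolding is_eigval_seq_def by (meson le_less_trans)
  have sub: "{i. l i = t} \<subseteq> {i. m i = t}"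
  proof
    fix i assume i: "i \<in> {i. l i = t}"
    have "i < n"
    proof (rule ccontr)
      assume "\<not> i < n"
      moreover have "decseq l" using l unfolding is_eigval_seq_def by simp
      ultimately have "l i \<le> l n" by (simp add: decseqD)
      then show False using i lt by simp
    qed
    then show "i \<in> {i. m i = t}" using i eq by simp
  qed
  moreover have "n \<in> {i. m i = t}" "n \<notin> {i. l i = t}" using lt by (auto simp: t_def)
  ultimately have "{i. l i = t} \<subset> {i. m i = t}" by blast
  then have "card {i. l i = t} < card {i. m i = t}"
    using m t unfolding is_eigval_seq_def by (intro psubset_card_mono) auto
  then show False using l m t unfolding is_eigval_seq_def by simp
qed

lemma is_eigval_seq_unique:
  assumes l: "is_eigval_seq a l" and m: "is_eigval_seq a m"
  shows "l = m"
proof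
  fix n show "l n = m n"
  proof (induction n rule: less_induct)
    case (less n)
    show ?case
      by (rule antisym) (use is_eigval_seq_le[OF l m, of n] is_eigval_seq_le[OF m l, of n] less in auto)
  qed
qed

lemma eigensystem_eigval: "eigensystem e l a \<Longrightarrow> eigval a = l"
  unfolding eigval_def using eigensystem_is_eigval_seq is_eigval_seq_unique by (blast intro: the_equality)


section \<open>Functional calculus on an eigensystem\<close>

lemma weierstrass_poly:
  fixes f :: "real \<Rightarrow> real"
  assumes "continuous_on {0..M} f"
  obtains q :: "nat \<Rightarrow> real poly" where "uniform_limit {0..M} (\<lambda>n. poly (q n)) f sequentially"
proof -
  have "\<exists>q :: real poly. \<forall>t\<in>{0..M}. \<bar>poly q t - f t\<bar> < 1 / real (Suc n)" for n
  proof -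
    obtain g where g: "real_polynomial_function g" "\<And>t. t \<in> {0..M} \<Longrightarrow> \<bar>f t - g t\<bar> < 1 / real (Suc n)"
      by (rule Stone_Weierstrass_real_polynomial_function[OF compact_Icc assms, of "1 / real (Suc n)"]) auto
    obtain c d where "g = (\<lambda>x. \<Sum>i\<le>d. c i * x ^ i)"
      using real_polynomial_function_imp_sum[OF g(1)] by blast
    then have "poly (\<Sum>i\<le>d. monom (c i) i) t = g t" for t
      by (simp add: poly_sum poly_monom)
    then have "\<bar>poly (\<Sum>i\<le>d. monom (c i) i) t - f t\<bar> < 1 / real (Suc n)" if "t \<in> {0..M}" for t
      using g(2)[OF that] by (simp only: abs_minus_commute)
    then show ?thesis by blast
  qed
  then obtain q :: "nat \<Rightarrow> real poly" where q: "\<And>n t. t \<in> {0..M} \<Longrightarrow> \<bar>poly (q n) t - f t\<bar> < 1 / real (Suc n)"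
    by metis
  have "uniform_limit {0..M} (\<lambda>n. poly (q n)) f sequentially"
  proof (rule uniform_limitI)
    fix r :: real assume "0 < r"
    then obtain N where N: "1 / real (Suc N) < r" using nat_approx_posE by blast
    show "\<forall>\<^sub>F n in sequentially. \<forall>t\<in>{0..M}. dist (poly (q n) t) (f t) < r"
    proof (rule eventually_mono[OF eventually_ge_at_top[of N]], intro ballI)
      fix n t assume "N \<le> n" "t \<in> {0..M}"
      have "1 / real (Suc n) \<le> 1 / real (Suc N)" using \<open>N \<le> n\<close> by (simp add: frac_le)
      then show "dist (poly (q n) t) (f t) < r" using q[OF \<open>t \<in> {0..M}\<close>, of n] N by (simp add: dist_real_def)
    qed
  qed
  then show ?thesis by (rule that)
qed

lemma op_power_bounded_ops: "a \<in> bounded_ops \<Longrightarrow> ((o\<^sub>L) a ^^ i) id_blinfun \<in> bounded_ops"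
  by (induction i) (simp_all add: bounded_ops_compose)

lemma op_poly_bounded_ops: "a \<in> bounded_ops \<Longrightarrow> op_poly q a \<in> bounded_ops"
  unfolding op_poly_def by (intro bounded_ops_sum bounded_ops_scaleR op_power_bounded_ops)

lemma op_poly_eigenvector:
  assumes "blinfun_apply a x = t *\<^sub>R x"
  shows "blinfun_apply (op_poly q a) x = poly q t *\<^sub>R x"
proof -
  have "blinfun_apply (((o\<^sub>L) a ^^ i) id_blinfun) x = t ^ i *\<^sub>R x" for i
    by (induction i) (simp_all add: assms blinfun.scaleR_right mult.commute)
  then show ?thesis
    by (simp add: op_poly_def poly_altdef blinfun.sum_left blinfun.scaleR_left scaleR_sum_left)
qed

text \<open>All l_i and the point 0, which represents the orthogonal complement, lie in [0, |a|]. So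
  the supremum distance of the polynomials there controls the operator distance.\<close>

lemma op_poly_diff_norm_le:
  assumes ea: "eigensystem e l a"
    and le: "\<And>t. t \<in> {0..norm a} \<Longrightarrow> \<bar>poly q t - poly q' t\<bar> \<le> B"
  shows "norm (op_poly q a - op_poly q' a) \<le> B"
proof (rule norm_diagonal_le)
  note ab = eigensystem_bounded_ops[OF ea]
  show "orthonormal e" by (rule eigensystem_orthonormal[OF ea])
  show "op_poly q a - op_poly q' a \<in> bounded_ops"
    using bounded_ops_add[OF op_poly_bounded_ops[OF ab] bounded_ops_scaleR[OF op_poly_bounded_ops[OF ab], of "-1"]] by simp
  show "blinfun_apply (op_poly q a - op_poly q' a) (e i) = (poly q (l i) - poly q' (l i)) *\<^sub>R e i" for i
    by (simp add: blinfun.diff_left op_poly_eigenvector[OF eigensystem_apply[OF ea]] scaleR_left_diff_distrib)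
  show "\<bar>poly q (l i) - poly q' (l i)\<bar> \<le> B" for i
    using le[of "l i"] eigensystem_nonneg[OF ea, of i] eigensystem_le_norm[OF ea, of i] by simp
  show "blinfun_apply (op_poly q a - op_poly q' a) y = (poly q 0 - poly q' 0) *\<^sub>R y"
    if "\<And>i. cinner y (e i) = 0" for y
    using eigensystem_perp[OF ea that]
    by (simp add: blinfun.diff_left op_poly_eigenvector[of a y 0] scaleR_left_diff_distrib)
  show "\<bar>poly q 0 - poly q' 0\<bar> \<le> B" using le[of 0] by simp
qed

lemma uniform_limit_eventually_close:
  fixes f :: "'a \<Rightarrow> real"
  assumes "uniform_limit S q f sequentially" "uniform_limit S q' f sequentially" "0 < r"
  shows "\<exists>N. \<forall>m\<ge>N. \<forall>n\<ge>N. \<forall>t\<in>S. \<bar>q m t - q' n t\<bar> \<le> r"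
proof -
  from uniform_limitD[OF assms(1), of "r/2"] \<open>0 < r\<close>
  obtain N where N: "\<And>n t. N \<le> n \<Longrightarrow> t \<in> S \<Longrightarrow> dist (q n t) (f t) < r / 2"
    unfolding eventually_sequentially by auto
  from uniform_limitD[OF assms(2), of "r/2"] \<open>0 < r\<close>
  obtain N' where N': "\<And>n t. N' \<le> n \<Longrightarrow> t \<in> S \<Longrightarrow> dist (q' n t) (f t) < r / 2"
    unfolding eventually_sequentially by auto
  have "\<bar>q m t - q' n t\<bar> \<le> r" if "max N N' \<le> m" "max N N' \<le> n" "t \<in> S" for m n t
    using N[of m t] N'[of n t] that unfolding dist_real_def by linarith
  then show ?thesis by blast
qed

text \<open>The supremum bound makes one approximating sequence Cauchy and forces any other to the
  same limit. Uniqueness of the described operator uses \<open>q\<close>: a condition on all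
  approximating sequences determines a limit only because one exists.\<close>

lemma op_cfc_tendsto:
  fixes a :: "'h::complex_hilbert_space op" and q :: "nat \<Rightarrow> real poly"
  assumes ea: "eigensystem e l a" and f: "continuous_on {0..norm a} f"
    and q: "uniform_limit {0..norm a} (\<lambda>n. poly (q n)) f sequentially"
  shows "(\<lambda>n. op_poly (q n) a) \<longlonglongrightarrow> op_cfc f a"
proof -
  have "Cauchy (\<lambda>n. op_poly (q n) a)"
  proof (rule CauchyI)
    fix r :: real assume "0 < r"
    then have "0 < r / 2" by simp
    from uniform_limit_eventually_close[OF q q this]
    obtain N where N: "\<And>m n t. N \<le> m \<Longrightarrow> N \<le> n \<Longrightarrow> t \<in> {0..norm a} \<Longrightarrow> \<bar>poly (q m) t - poly (q n) t\<bar> \<le> r / 2"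
      by blast
    have "norm (op_poly (q m) a - op_poly (q n) a) < r" if "N \<le> m" "N \<le> n" for m n
      using op_poly_diff_norm_le[OF ea N[OF that]] \<open>0 < r\<close> by (simp add: field_simps)
    then show "\<exists>M. \<forall>m\<ge>M. \<forall>n\<ge>M. norm (op_poly (q m) a - op_poly (q n) a) < r" by blast
  qed
  then obtain b where b: "(\<lambda>n. op_poly (q n) a) \<longlonglongrightarrow> b"
    using Cauchy_convergent convergent_def by blast
  have b': "(\<lambda>n. op_poly (q' n) a) \<longlonglongrightarrow> b"
    if q': "uniform_limit {0..norm a} (\<lambda>n. poly (q' n)) f sequentially" for q' :: "nat \<Rightarrow> real poly"
  proof -
    have "(\<lambda>n. op_poly (q' n) a - op_poly (q n) a) \<longlonglongrightarrow> 0"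
    proof (rule LIMSEQ_I)
      fix r :: real assume "0 < r"
      then have "0 < r / 2" by simp
    from uniform_limit_eventually_close[OF q' q this]
    obtain N where N: "\<And>m n t. N \<le> m \<Longrightarrow> N \<le> n \<Longrightarrow> t \<in> {0..norm a} \<Longrightarrow> \<bar>poly (q' m) t - poly (q n) t\<bar> \<le> r / 2"
      by blast
      have "norm (op_poly (q' n) a - op_poly (q n) a - 0) < r" if "N \<le> n" for n
        using op_poly_diff_norm_le[OF ea N[OF that that]] \<open>0 < r\<close> by (simp add: field_simps)
      then show "\<exists>M. \<forall>n\<ge>M. norm (op_poly (q' n) a - op_poly (q n) a - 0) < r" by blast
    qed
    then show ?thesis by (rule Lim_transform[OF b])
  qed
  have "op_cfc f a = b"
    unfolding op_cfc_def
  proof (rule the_equality)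
    show "\<forall>q. uniform_limit {0..norm a} (\<lambda>n. poly (q n)) f sequentially \<longrightarrow> (\<lambda>n. op_poly (q n) a) \<longlonglongrightarrow> b"
      using b' by simp
    show "c = b" if "\<forall>q. uniform_limit {0..norm a} (\<lambda>n. poly (q n)) f sequentially \<longrightarrow> (\<lambda>n. op_poly (q n) a) \<longlonglongrightarrow> c" for c
      by (rule LIMSEQ_unique[OF that[rule_format, OF q] b])
  qed
  with b show ?thesis by simp
qed

lemma op_cfc_eigenvector:
  fixes a :: "'h::complex_hilbert_space op"
  assumes ea: "eigensystem e l a" and f: "continuous_on {0..norm a} f"
    and x: "blinfun_apply a x = t *\<^sub>R x" "t \<in> {0..norm a}"
  shows "blinfun_apply (op_cfc f a) x = f t *\<^sub>R x"
proof -
  obtain q where q: "uniform_limit {0..norm a} (\<lambda>n. poly (q n)) f sequentially"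
    using weierstrass_poly[OF f] .
  have "(\<lambda>n. blinfun_apply (op_poly (q n) a) x) \<longlonglongrightarrow> blinfun_apply (op_cfc f a) x"
    by (intro tendsto_intros op_cfc_tendsto[OF ea f q])
  moreover have "(\<lambda>n. poly (q n) t *\<^sub>R x) \<longlonglongrightarrow> f t *\<^sub>R x"
    by (intro tendsto_intros tendsto_uniform_limitI[OF q x(2)])
  ultimately show ?thesis
    using LIMSEQ_unique by (force simp: op_poly_eigenvector[OF x(1)])
qed

lemma op_cfc_bounded_ops:
  assumes ea: "eigensystem e l a" and f: "continuous_on {0..norm a} f"
  shows "op_cfc f a \<in> bounded_ops"
proof -
  obtain q where q: "uniform_limit {0..norm a} (\<lambda>n. poly (q n)) f sequentially"
    using weierstrass_poly[OF f] .
  show ?thesis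
    by (rule bounded_ops_LIMSEQ[OF op_poly_bounded_ops op_cfc_tendsto[OF ea f q]])
       (rule eigensystem_bounded_ops[OF ea])
qed

text \<open>For r > 0 the power function is continuous at 0, increasing, and has value 0 there, so
  order, convergence to 0 and vanishing on the complement are all inherited with the same vectors
  \<open>e\<close>.\<close>

lemma eigensystem_op_powr:
  assumes ea: "eigensystem e l a" and r: "0 < r"
  shows "eigensystem e (\<lambda>i. l i powr r) (op_powr a r)"
proof -
  have f: "continuous_on {0..norm a} (\<lambda>t. t powr r)"
    using r by (intro continuous_on_powr' continuous_intros) auto
  note nn = eigensystem_nonneg[OF ea]
  show ?thesis
    unfolding eigensystem_def op_powr_def
  proof (intro conjI allI impI)
    show "op_cfc (\<lambda>t. t powr r) a \<in> bounded_ops" by (rule op_cfc_bounded_ops[OF ea f])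
    show "orthonormal e" by (rule eigensystem_orthonormal[OF ea])
    show "decseq (\<lambda>i. l i powr r)"
      using eigensystem_decseq[OF ea] nn r by (auto simp: decseq_def intro!: powr_mono2)
    show "(\<lambda>i. l i powr r) \<longlonglongrightarrow> 0"
      using tendsto_powr2[OF eigensystem_tendsto[OF ea] tendsto_const, of r] nn r by simp
    show "blinfun_apply (op_cfc (\<lambda>t. t powr r) a) (e i) = (l i powr r) *\<^sub>R e i" for i
      by (rule op_cfc_eigenvector[OF ea f eigensystem_apply[OF ea]])
         (simp add: nn eigensystem_le_norm[OF ea])
    show "blinfun_apply (op_cfc (\<lambda>t. t powr r) a) y = 0" if "\<forall>i. cinner y (e i) = 0" for y
      using op_cfc_eigenvector[OF ea f, of y 0] eigensystem_perp[OF ea, of y] that by simp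
  qed simp
qed


section \<open>The spectral theorem for positive compact operators\<close>

text \<open>The point where infinite dimension enters: finitely many vectors do not span, so the
  recursive choice of eigenvectors never stops.\<close>

lemma infinite_dim_unit_perp:
  fixes e :: "nat \<Rightarrow> 'h::complex_hilbert_space"
  assumes inf: "\<nexists>B :: 'h set. finite B \<and> cvec.span B = UNIV"
    and on: "\<And>i j. i < n \<Longrightarrow> j < n \<Longrightarrow> cinner (e i) (e j) = (if i = j then 1 else 0)"
  obtains u where "norm u = 1" "\<And>i. i < n \<Longrightarrow> cinner u (e i) = 0"
proof -
  have "cvec.span (e ` {..<n}) \<noteq> UNIV" using inf by blast
  then obtain x where x: "x \<notin> cvec.span (e ` {..<n})" by blast
  define w where "w = x - (\<Sum>i<n. cinner x (e i) *\<^sub>C e i)"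
  have "(\<Sum>i<n. cinner x (e i) *\<^sub>C e i) \<in> cvec.span (e ` {..<n})"
    by (intro cvec.span_sum cvec.span_scale cvec.span_base) auto
  then have "w \<noteq> 0" using x by (auto simp: w_def)
  have "cinner w (e j) = 0" if "j < n" for j
  proof -
    have "cinner (\<Sum>i<n. cinner x (e i) *\<^sub>C e i) (e j) = (\<Sum>i<n. if i = j then cinner x (e i) else 0)"
      unfolding cinner.sum_left cinner_scaleC_left by (rule sum.cong) (auto simp: on that)
    then show ?thesis using that by (simp add: w_def cinner.diff_left)
  qed
  then show ?thesis
    using \<open>w \<noteq> 0\<close> by (intro that[of "(1 / norm w) *\<^sub>R w"]) (simp_all add: cinner.scaleR_left)
qed

context
  fixes a :: "'h::complex_hilbert_space op"
  assumes a: "a \<in> compact_ops"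
    and sa: "\<And>x y. cinner (blinfun_apply a x) y = cinner x (blinfun_apply a y)"
    and pos: "\<And>x. 0 \<le> Re (cinner (blinfun_apply a x) x)"
begin

lemma Re_cinner_sa_commute: "Re (cinner (blinfun_apply a x) y) = Re (cinner (blinfun_apply a y) x)"
  by (metis cinner_commute cnj.sel(1) sa)

text \<open>Positivity of the form at \<open>x - t a x\<close> with \<open>t = 1/M\<close>.\<close>

lemma positive_norm_square_le:
  assumes bd: "Re (cinner (blinfun_apply a (blinfun_apply a x)) (blinfun_apply a x)) \<le> M * (norm (blinfun_apply a x))\<^sup>2"
    and bdx: "Re (cinner (blinfun_apply a x) x) \<le> M * (norm x)\<^sup>2" and "0 \<le> M"
  shows "(norm (blinfun_apply a x))\<^sup>2 \<le> M * Re (cinner (blinfun_apply a x) x)"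
proof -
  let ?y = "blinfun_apply a x"
  have form: "0 \<le> Re (cinner ?y x) - 2 * t * (norm ?y)\<^sup>2 + t\<^sup>2 * (M * (norm ?y)\<^sup>2)" for t :: real
  proof -
    have "0 \<le> Re (cinner (blinfun_apply a (x - t *\<^sub>R ?y)) (x - t *\<^sub>R ?y))" by (rule pos)
    also have "\<dots> = Re (cinner ?y x) - 2 * t * (norm ?y)\<^sup>2 + t\<^sup>2 * Re (cinner (blinfun_apply a ?y) ?y)"
      using Re_cinner_sa_commute[of ?y x]
      by (simp add: blinfun.diff_right blinfun.scaleR_right cinner.diff_left cinner.diff_right
          cinner.scaleR_left cinner.scaleR_right cinner_self power2_eq_square algebra_simps)
    also have "\<dots> \<le> Re (cinner ?y x) - 2 * t * (norm ?y)\<^sup>2 + t\<^sup>2 * (M * (norm ?y)\<^sup>2)"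
      by (intro add_left_mono mult_left_mono bd) simp
    finally show ?thesis .
  qed
  show ?thesis
  proof (cases "M = 0")
    \<comment> \<open>There is no step size 1/M; t = 1 gives 2 |ax|^2 <= <ax, x> <= 0.\<close>
    case True
    have "2 * (norm ?y)\<^sup>2 \<le> Re (cinner ?y x)" using form[of 1] True by simp
    moreover have "Re (cinner ?y x) \<le> 0" using bdx True by simp
    ultimately have "2 * (norm ?y)\<^sup>2 \<le> 0" by (rule order_trans)
    then show ?thesis using True by simp
  next
    case False
    then have "(1 / M)\<^sup>2 * (M * (norm ?y)\<^sup>2) = (1 / M) * (norm ?y)\<^sup>2"
      by (simp add: power2_eq_square)
    then have "(1 / M) * (norm ?y)\<^sup>2 \<le> Re (cinner ?y x)" using form[of "1 / M"] by simp
    then show ?thesis using False \<open>0 \<le> M\<close> by (simp add: field_simps)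
  qed
qed

text \<open>Maximisation of the quadratic form on the unit vectors of V. Near-maximisers are
  approximate eigenvectors, and compactness extracts a convergent subsequence. The norm bound on V
  is exported because it later yields monotone eigenvalues and vanishing on the complement.\<close>

lemma top_eigenvector:
  assumes scaleV: "\<And>r x. x \<in> V \<Longrightarrow> r *\<^sub>R x \<in> V"
    and closed: "closed V" and inv: "\<And>x. x \<in> V \<Longrightarrow> blinfun_apply a x \<in> V"
    and ne: "v \<in> V" "norm v = 1"
  obtains u M where "u \<in> V" "norm u = 1" "0 \<le> M" "blinfun_apply a u = M *\<^sub>R u"
    "\<And>y. y \<in> V \<Longrightarrow> norm (blinfun_apply a y) \<le> M * norm y"
proof -
  let ?Q = "\<lambda>x. Re (cinner (blinfun_apply a x) x)"
  define Q where "Q = ?Q ` {x \<in> V. norm x = 1}"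
  define M where "M = Sup Q"
  have Q_ne: "Q \<noteq> {}" using ne by (auto simp: Q_def)
  have "?Q x \<le> norm a" if "norm x = 1" for x
  proof -
    have "?Q x \<le> norm (blinfun_apply a x) * norm x"
      using complex_Re_le_cmod cauchy_schwarz order_trans by blast
    then show ?thesis using norm_blinfun[of a x] that by simp
  qed
  then have bdd: "bdd_above Q" by (auto simp: Q_def intro!: bdd_aboveI[of _ "norm a"])
  have le1: "?Q x \<le> M" if "x \<in> V" "norm x = 1" for x
    unfolding M_def by (rule cSup_upper[OF _ bdd]) (use that in \<open>auto simp: Q_def\<close>)
  have "0 \<le> M" using le1[OF ne] pos[of v] by linarith
  have le: "?Q x \<le> M * (norm x)\<^sup>2" if "x \<in> V" for x
  proof (cases "x = 0")
    case False
    have "?Q ((1 / norm x) *\<^sub>R x) \<le> M"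
      using False that by (intro le1 scaleV) auto
    then show ?thesis using False
      by (simp add: blinfun.scaleR_right cinner.scaleR_left cinner.scaleR_right field_simps power2_eq_square)
  qed (simp add: cinner.zero_left)
  have sq: "(norm (blinfun_apply a x))\<^sup>2 \<le> M * ?Q x" if "x \<in> V" for x
    using that by (intro positive_norm_square_le le inv \<open>0 \<le> M\<close>)
  have bound: "norm (blinfun_apply a y) \<le> M * norm y" if "y \<in> V" for y
  proof (rule power2_le_imp_le)
    have "(norm (blinfun_apply a y))\<^sup>2 \<le> M * (M * (norm y)\<^sup>2)"
      using sq[OF that] mult_left_mono[OF le[OF that] \<open>0 \<le> M\<close>] by linarith
    then show "(norm (blinfun_apply a y))\<^sup>2 \<le> (M * norm y)\<^sup>2"
      by (simp add: power_mult_distrib power2_eq_square mult_ac)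
    show "0 \<le> M * norm y" using \<open>0 \<le> M\<close> by simp
  qed
  show ?thesis
  proof (cases "M = 0")
    case True
    then have "blinfun_apply a v = M *\<^sub>R v" using bound[OF ne(1)] by simp
    then show ?thesis by (intro that[OF ne \<open>0 \<le> M\<close> _ bound])
  next
    case False
    then have "0 < M" using \<open>0 \<le> M\<close> by simp
    have "\<exists>x. x \<in> V \<and> norm x = 1 \<and> M - 1 / real (Suc n) < ?Q x" for n
      using less_cSupD[OF Q_ne, of "M - 1 / real (Suc n)"] by (auto simp: M_def[symmetric]) (auto simp: Q_def)
    then obtain s where s: "\<And>n. s n \<in> V" "\<And>n. norm (s n) = 1" "\<And>n. M - 1 / real (Suc n) < ?Q (s n)"
      by metis
    obtain r z where r: "strict_mono r" and z: "(\<lambda>n. blinfun_apply a (s (r n))) \<longlonglongrightarrow> z"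
      by (rule compact_ops_subseq[OF a, of s 1]) (simp_all add: s)
    \<comment> \<open>Expanding the square and using |a s|^2 <= M <a s, s> leaves M (M - <a s, s>),
      which is small for near-maximisers.\<close>
    have close: "(norm (blinfun_apply a (s n) - M *\<^sub>R s n))\<^sup>2 \<le> M * (1 / real (Suc n))" for n
    proof -
      have "(norm (blinfun_apply a (s n) - M *\<^sub>R s n))\<^sup>2 = (norm (blinfun_apply a (s n)))\<^sup>2 - 2 * M * ?Q (s n) + M\<^sup>2"
        by (simp add: norm_diff_square cinner.scaleR_right s power_mult_distrib)
      also have "\<dots> \<le> M * ?Q (s n) - 2 * M * ?Q (s n) + M\<^sup>2" using sq[OF s(1)] by simp
      also have "\<dots> = M * (M - ?Q (s n))" by (simp add: power2_eq_square algebra_simps)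
      also have "\<dots> \<le> M * (1 / real (Suc n))"
        using s(3)[of n] \<open>0 \<le> M\<close> by (intro mult_left_mono) linarith+
      finally show ?thesis .
    qed
    have "(\<lambda>n. M * (1 / real (Suc n))) \<longlonglongrightarrow> 0"
      by (intro tendsto_mult_right_zero LIMSEQ_Suc[OF lim_1_over_n])
    then have "(\<lambda>n. (norm (blinfun_apply a (s n) - M *\<^sub>R s n))\<^sup>2) \<longlonglongrightarrow> 0"
    proof (rule Lim_null_comparison[rotated])
      show "\<forall>\<^sub>F n in sequentially. norm ((norm (blinfun_apply a (s n) - M *\<^sub>R s n))\<^sup>2) \<le> M * (1 / real (Suc n))"
        using close by (intro always_eventually) simp
    qed
    from tendsto_real_sqrt[OF this] have "(\<lambda>n. blinfun_apply a (s n) - M *\<^sub>R s n) \<longlonglongrightarrow> 0"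
      by (simp add: tendsto_norm_zero_iff)
    from LIMSEQ_subseq_LIMSEQ[OF this r]
    have "(\<lambda>n. blinfun_apply a (s (r n)) - M *\<^sub>R s (r n)) \<longlonglongrightarrow> 0"
      by (simp add: o_def)
    from tendsto_diff[OF z this] have "(\<lambda>n. M *\<^sub>R s (r n)) \<longlonglongrightarrow> z" by simp
    from tendsto_scaleR[OF tendsto_const[of "1 / M"] this]
    have sl: "(\<lambda>n. s (r n)) \<longlonglongrightarrow> (1 / M) *\<^sub>R z" using \<open>0 < M\<close> by simp
    define u where "u = (1 / M) *\<^sub>R z"
    have "u \<in> V" using closed_sequentially[OF closed _ sl] s(1) by (simp add: u_def)
    moreover have "norm u = 1"
      using tendsto_norm[OF sl] unfolding s(2) u_def[symmetric] by (simp add: LIMSEQ_const_iff)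
    moreover have "(\<lambda>n. blinfun_apply a (s (r n))) \<longlonglongrightarrow> blinfun_apply a u"
      unfolding u_def by (intro tendsto_intros sl)
    from LIMSEQ_unique[OF this z] have "blinfun_apply a u = M *\<^sub>R u"
      using \<open>0 < M\<close> by (simp add: u_def)
    ultimately show ?thesis by (intro that[OF _ _ \<open>0 \<le> M\<close> _ bound])
  qed
qed

theorem compact_spectral_theorem:
  assumes inf: "\<nexists>B :: 'h set. finite B \<and> cvec.span B = UNIV"
  obtains e l where "eigensystem e l a"
proof -
  define V where "V e n = {x. \<forall>i<n. cinner x (e i) = 0}" for e :: "nat \<Rightarrow> 'h" and n :: nat
  define P where "P e n u \<longleftrightarrow> norm u = 1 \<and> u \<in> V e n \<and>
      (\<exists>M\<ge>0. blinfun_apply a u = M *\<^sub>R u \<and> (\<forall>y\<in>V e n. norm (blinfun_apply a y) \<le> M * norm y))"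
    for e :: "nat \<Rightarrow> 'h" and n u
  \<comment> \<open>Each e_n is a top eigenvector on the complement of its predecessors.
    \<open>P e n\<close> depends only on the values of e below n, as recursive choice
    requires.\<close>
  have "\<exists>e. \<forall>n. P e n (e n)"
  proof (rule dependent_wellorder_choice)
    fix r and f g :: "nat \<Rightarrow> 'h" and x :: nat
    assume "\<And>y. y < x \<Longrightarrow> f y = g y"
    then have "V f x = V g x" by (simp add: V_def)
    then show "P f x r = P g x r" by (simp add: P_def)
  next
    fix n :: nat and e assume IH: "\<And>i. i < n \<Longrightarrow> P e i (e i)"
    have ne0: "cinner (e i) (e j) = 0" if "j < i" "i < n" for i j
      using IH[OF that(2)] that(1) by (simp add: P_def V_def)
    have on: "cinner (e i) (e j) = (if i = j then 1 else 0)" if "i < n" "j < n" for i j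
    proof (cases i j rule: linorder_cases)
      case less
      then show ?thesis using ne0[of i j] that cinner_eq_zero_commute by force
    next
      case equal
      then show ?thesis using IH[OF that(1)] by (simp add: P_def cinner_self)
    next
      case greater
      then show ?thesis using ne0[of j i] that by simp
    qed
    obtain v where v: "norm v = 1" "\<And>i. i < n \<Longrightarrow> cinner v (e i) = 0"
      using infinite_dim_unit_perp[OF inf on] by blast
    have closed: "closed (V e n)"
    proof -
      have "V e n = (\<Inter>i\<in>{..<n}. {x. cinner x (e i) = 0})" by (auto simp: V_def)
      moreover have "closed {x. cinner x (e i) = 0}" for i
        by (intro closed_Collect_eq continuous_intros
            bounded_linear.continuous_on[OF cinner.bounded_linear_left])
      ultimately show ?thesis by auto
    qed
    \<comment> \<open>Self-adjointness moves a onto e_i, which is an eigenvector.\<close>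
    have inv: "blinfun_apply a x \<in> V e n" if "x \<in> V e n" for x
    proof -
      have "cinner (blinfun_apply a x) (e i) = 0" if i: "i < n" for i
      proof -
        obtain M where "blinfun_apply a (e i) = M *\<^sub>R e i" using IH[OF i] by (auto simp: P_def)
        then show ?thesis using \<open>x \<in> V e n\<close> i by (simp add: sa cinner.scaleR_right V_def)
      qed
      then show ?thesis by (simp add: V_def)
    qed
    obtain u M where "u \<in> V e n" "norm u = 1" "0 \<le> M" "blinfun_apply a u = M *\<^sub>R u"
      "\<And>y. y \<in> V e n \<Longrightarrow> norm (blinfun_apply a y) \<le> M * norm y"
      by (rule top_eigenvector[of "V e n" v, OF _ closed inv])
         (use v in \<open>auto simp: V_def cinner.scaleR_left\<close>)
    then show "\<exists>r. P e n r" by (auto simp: P_def)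
  qed
  then obtain e where e: "\<And>n. P e n (e n)" by blast
  have "\<forall>n. \<exists>M. 0 \<le> M \<and> blinfun_apply a (e n) = M *\<^sub>R e n \<and> (\<forall>y\<in>V e n. norm (blinfun_apply a y) \<le> M * norm y)"
    using e by (simp add: P_def)
  from choice[OF this] obtain l where l: "\<And>n. 0 \<le> l n" "\<And>n. blinfun_apply a (e n) = l n *\<^sub>R e n"
    and bd: "\<And>n y. y \<in> V e n \<Longrightarrow> norm (blinfun_apply a y) \<le> l n * norm y"
    by blast
  have nrm: "norm (e n) = 1" and eV: "e n \<in> V e n" for n using e[of n] by (simp_all add: P_def)
  have ne0: "cinner (e i) (e j) = 0" if "j < i" for i j
    using eV[of i] that by (simp add: V_def)
  have on: "orthonormal e"
    unfolding orthonormal_def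
  proof (intro allI)
    fix i j show "cinner (e i) (e j) = (if i = j then 1 else 0)"
      by (cases i j rule: linorder_cases)
         (use ne0[of i j] ne0[of j i] cinner_eq_zero_commute[of "e i" "e j"] in \<open>auto simp: cinner_self nrm\<close>)
  qed
  have dec: "decseq l"
  proof (rule decseq_SucI)
    fix n
    have "e (Suc n) \<in> V e n" using eV[of "Suc n"] by (simp add: V_def)
    from bd[OF this] show "l (Suc n) \<le> l n" using l(1)[of "Suc n"] by (simp add: l nrm)
  qed
  obtain L where L: "l \<longlonglongrightarrow> L" "\<And>n. L \<le> l n"
    using decseq_convergent[OF dec, of 0] l(1) by blast
  \<comment> \<open>For L > 0 the images of the e_n would be orthogonal of length at least L, hence
    without Cauchy subsequence, against compactness.\<close>
  have "L = 0"
  proof (rule ccontr)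
    assume "L \<noteq> 0"
    moreover have "0 \<le> L" by (rule LIMSEQ_le_const[OF L(1)]) (use l(1) in auto)
    ultimately have "0 < L" by simp
    obtain r z where r: "strict_mono r" and z: "(\<lambda>n. blinfun_apply a (e (r n))) \<longlonglongrightarrow> z"
      by (rule compact_ops_subseq[OF a, of e 1]) (simp_all add: nrm)
    obtain N where N: "\<And>m n. N \<le> m \<Longrightarrow> N \<le> n \<Longrightarrow> norm (blinfun_apply a (e (r m)) - blinfun_apply a (e (r n))) < L"
      using CauchyD[OF LIMSEQ_imp_Cauchy[OF z] \<open>0 < L\<close>] by blast
    have "r N \<noteq> r (Suc N)" using r by (simp add: strict_mono_eq)
    then have "(norm (l (r N) *\<^sub>R e (r N) - l (r (Suc N)) *\<^sub>R e (r (Suc N))))\<^sup>2 = (l (r N))\<^sup>2 + (l (r (Suc N)))\<^sup>2"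
      by (simp add: norm_diff_square cinner.scaleR_left cinner.scaleR_right orthonormal_cinner[OF on] nrm)
    moreover have "(norm (l (r N) *\<^sub>R e (r N) - l (r (Suc N)) *\<^sub>R e (r (Suc N))))\<^sup>2 < L\<^sup>2"
      using N[of N "Suc N"] \<open>0 < L\<close> by (intro power_strict_mono) (simp_all add: l)
    moreover have "L\<^sup>2 \<le> (l (r N))\<^sup>2" using L(2) \<open>0 < L\<close> by (intro power_mono) auto
    moreover have "0 \<le> (l (r (Suc N)))\<^sup>2" by simp
    ultimately show False by linarith
  qed
  with L have lim: "l \<longlonglongrightarrow> 0" by simp
  \<comment> \<open>Such y lies in every V e n, so |a y| <= l_n |y| for all n.\<close>
  have "blinfun_apply a y = 0" if "\<forall>i. cinner y (e i) = 0" for y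
  proof -
    have "(\<lambda>n. l n * norm y) \<longlonglongrightarrow> 0 * norm y" by (intro tendsto_intros lim)
    moreover have "norm (blinfun_apply a y) \<le> l n * norm y" for n
      using that by (intro bd) (simp add: V_def)
    ultimately have "norm (blinfun_apply a y) \<le> 0 * norm y"
      by (intro LIMSEQ_le_const) auto
    then show ?thesis by simp
  qed
  then have "eigensystem e l a"
    using compact_ops_bounded[OF a] on dec l lim by (simp add: eigensystem_def)
  then show ?thesis by (rule that)
qed

end


section \<open>Ky Fan's maximum principle\<close>

lemma cmod_cinner_commute:
  fixes x :: "'h::complex_hilbert_space"
  shows "cmod (cinner x y) = cmod (cinner y x)"
  by (metis cinner_commute complex_mod_cnj)

text \<open>Bathtub principle: total mass at most k with density at most 1 is best placed on the k
  largest entries. Subtracting the level s_k makes this a termwise estimate.\<close>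

lemma decseq_weighted_sum_le:
  fixes s c :: "nat \<Rightarrow> real"
  assumes dec: "decseq s" and nn: "\<And>i. 0 \<le> s i"
    and c: "\<And>j. 0 \<le> c j" "\<And>j. c j \<le> 1" "(\<Sum>j<N. c j) \<le> real k"
  shows "(\<Sum>j<N. s j * c j) \<le> (\<Sum>j<k. s j)"
proof -
  have "s j * c j \<le> s k * c j + (if j < k then s j - s k else 0)" for j
  proof (cases "j < k")
    case True
    then have "(s j - s k) * c j \<le> s j - s k"
      using decseqD[OF dec, of j k] by (intro mult_left_le c) simp
    then show ?thesis using True by (simp add: algebra_simps)
  next
    case False
    then show ?thesis using decseqD[OF dec, of k j] c(1)[of j] by (simp add: mult_right_mono)
  qed
  then have "(\<Sum>j<N. s j * c j) \<le> (\<Sum>j<N. s k * c j + (if j < k then s j - s k else 0))"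
    by (rule sum_mono)
  also have "\<dots> = s k * (\<Sum>j<N. c j) + (\<Sum>j\<in>{..<N} \<inter> {..<k}. s j - s k)"
    by (simp add: sum.distrib sum_distrib_left sum.inter_restrict)
  also have "\<dots> \<le> s k * real k + (\<Sum>j<k. s j - s k)"
    using decseqD[OF dec] by (intro add_mono mult_left_mono c nn sum_mono2) auto
  also have "\<dots> = (\<Sum>j<k. s j)" by (simp add: sum_subtractf mult.commute)
  finally show ?thesis .
qed

text \<open>Where \<open>s i = 0\<close> the vector \<open>h i\<close> may vanish, so \<open>h\<close> is only required to be a Bessel
  sequence.\<close>

definition singular_system ::
    "(nat \<Rightarrow> 'h) \<Rightarrow> (nat \<Rightarrow> 'h) \<Rightarrow> (nat \<Rightarrow> real) \<Rightarrow> 'h::complex_hilbert_space op \<Rightarrow> bool" where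
  "singular_system e h s a \<longleftrightarrow> a \<in> bounded_ops \<and> orthonormal e \<and> bessel h \<and> decseq s \<and> (\<forall>i. 0 \<le> s i) \<and>
     (\<forall>i. blinfun_apply a (e i) = s i *\<^sub>R h i) \<and> (\<forall>i. s i \<noteq> 0 \<longrightarrow> norm (h i) = 1) \<and>
     (\<forall>y. (\<forall>i. cinner y (e i) = 0) \<longrightarrow> blinfun_apply a y = 0)"

text \<open>Expanding f_i along e turns the pairing into a sum over j of s_j times the sum over i of
  <f_i, e_j><h_j, g_i>. The inner sums are bounded by weights c_j in [0, 1] of total at most
  k.\<close>

lemma singular_system_sum_le:
  fixes f g :: "nat \<Rightarrow> 'h::complex_hilbert_space"
  assumes sys: "singular_system e h s a" and f: "bessel f" and g: "bessel g"
  shows "cmod (\<Sum>i<k. cinner (blinfun_apply a (f i)) (g i)) \<le> (\<Sum>i<k. s i)"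
proof -
  have ab: "a \<in> bounded_ops" and e: "orthonormal e" and h: "bessel h" and dec: "decseq s"
    and nn: "\<And>i. 0 \<le> s i" and ae: "\<And>i. blinfun_apply a (e i) = s i *\<^sub>R h i"
    and perp: "\<And>y. (\<And>i. cinner y (e i) = 0) \<Longrightarrow> blinfun_apply a y = 0"
    using sys by (auto simp: singular_system_def)
  define A where "A N = (\<Sum>i<k. \<Sum>j<N. cinner (f i) (e j) * complex_of_real (s j) * cinner (h j) (g i))" for N
  have lim: "A \<longlonglongrightarrow> (\<Sum>i<k. cinner (blinfun_apply a (f i)) (g i))"
    unfolding A_def
  proof (rule tendsto_sum)
    fix i
    obtain y where y: "\<And>j. cinner y (e j) = 0"
      and z: "(\<lambda>N. (\<Sum>j<N. cinner (f i) (e j) *\<^sub>C e j) + y) \<longlonglongrightarrow> f i"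
      using orthonormal_expansion[OF e] by blast
    have "(\<lambda>N. cinner (blinfun_apply a ((\<Sum>j<N. cinner (f i) (e j) *\<^sub>C e j) + y)) (g i))
        \<longlonglongrightarrow> cinner (blinfun_apply a (f i)) (g i)"
      by (intro cinner.tendsto tendsto_intros z)
    then show "(\<lambda>N. \<Sum>j<N. cinner (f i) (e j) * complex_of_real (s j) * cinner (h j) (g i))
        \<longlonglongrightarrow> cinner (blinfun_apply a (f i)) (g i)"
      using perp[OF y]
      by (simp add: blinfun.add_right blinfun_apply_sum_scaleC[OF ab] ae scaleR_scaleC scaleC_scaleC
          cinner.sum_left cinner_scaleC_left)
  qed
  define u where "u i j = cmod (cinner (f i) (e j))" for i j
  define v where "v i j = cmod (cinner (g i) (h j))" for i j
  \<comment> \<open>Arithmetic-geometric mean of the two coefficient families. Bessel for f and g,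
    tested at e_j and h_j, gives c_j <= 1; Bessel for e and h, tested at f_i and g_i, gives total at
    most k.\<close>
  define c where "c j = (\<Sum>i<k. ((u i j)\<^sup>2 + (v i j)\<^sup>2) / 2)" for j
  have bes: "(\<Sum>i<n. (cmod (cinner x (d i)))\<^sup>2) \<le> 1" if "bessel d" "norm x \<le> 1"
    for d n and x :: 'h
  proof -
    have "(\<Sum>i<n. (cmod (cinner x (d i)))\<^sup>2) \<le> (norm x)\<^sup>2" using that(1) by (simp add: bessel_def)
    then show ?thesis using power_le_one[of "norm x" 2] that(2) by simp
  qed
  have c_le1: "c j \<le> 1" for j
  proof -
    have "(\<Sum>i<k. (u i j)\<^sup>2) \<le> 1" "(\<Sum>i<k. (v i j)\<^sup>2) \<le> 1"
      using bes[OF f, of "e j" k] bes[OF g, of "h j" k] bessel_norm_le[OF h]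
        bessel_norm_le[OF orthonormal_bessel[OF e]]
      by (simp_all add: u_def v_def cmod_cinner_commute[of "e j"] cmod_cinner_commute[of "h j"])
    then show ?thesis by (simp add: c_def sum.distrib flip: sum_divide_distrib)
  qed
  have c_sum: "(\<Sum>j<N. c j) \<le> real k" for N
  proof -
    have "(\<Sum>j<N. ((u i j)\<^sup>2 + (v i j)\<^sup>2) / 2) \<le> 1" for i
      using bes[OF orthonormal_bessel[OF e], of "f i" N] bes[OF h, of "g i" N]
        bessel_norm_le[OF f] bessel_norm_le[OF g]
      by (simp add: u_def v_def sum.distrib flip: sum_divide_distrib)
    then have "(\<Sum>i<k. \<Sum>j<N. ((u i j)\<^sup>2 + (v i j)\<^sup>2) / 2) \<le> (\<Sum>i<k. 1)" by (intro sum_mono)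
    then show ?thesis unfolding c_def by (subst sum.swap) simp
  qed
  have bound: "cmod (A N) \<le> (\<Sum>i<k. s i)" for N
  proof -
    have "cmod (A N) \<le> (\<Sum>i<k. \<Sum>j<N. u i j * s j * v i j)"
      unfolding A_def u_def v_def
      by (intro order_trans[OF norm_sum] sum_mono)
         (simp add: norm_mult nn cmod_cinner_commute[of "h _"])
    also have "\<dots> = (\<Sum>j<N. s j * (\<Sum>i<k. u i j * v i j))"
      by (subst sum.swap) (simp add: sum_distrib_left mult_ac)
    also have "\<dots> \<le> (\<Sum>j<N. s j * c j)"
    proof (intro sum_mono mult_left_mono nn)
      fix j
      show "(\<Sum>i<k. u i j * v i j) \<le> c j"
        unfolding c_def
      proof (rule sum_mono)
        fix i show "u i j * v i j \<le> ((u i j)\<^sup>2 + (v i j)\<^sup>2) / 2"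
          using sum_squares_bound[of "u i j" "v i j"] by simp
      qed
    qed
    also have "\<dots> \<le> (\<Sum>i<k. s i)"
      by (rule decseq_weighted_sum_le[OF dec nn _ c_le1 c_sum]) (simp add: c_def sum_nonneg)
    finally show ?thesis .
  qed
  show ?thesis
    by (rule LIMSEQ_le_const2[OF tendsto_norm[OF lim]]) (use bound in blast)
qed

lemma singular_system_sum_eq:
  assumes sys: "singular_system e h s a"
  shows "(\<Sum>i<k. cinner (blinfun_apply a (e i)) (h i)) = complex_of_real (\<Sum>i<k. s i)"
  unfolding of_real_sum
proof (rule sum.cong[OF refl])
  fix i
  show "cinner (blinfun_apply a (e i)) (h i) = complex_of_real (s i)"
    \<comment> \<open>If s_i = 0 both sides vanish, even where h_i is not a unit vector.\<close>
    using sys by (cases "s i = 0") (auto simp: singular_system_def cinner.scaleR_left cinner_self scaleR_conv_of_real cinner.zero_left)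
qed

lemma singular_system_bessel:
  assumes "singular_system e h s a"
  shows "bessel e" "bessel h"
  using assms orthonormal_bessel by (auto simp: singular_system_def)

section \<open>Singular values and the variational form of their partial sums\<close>

definition singular_value :: "'h::complex_hilbert_space op \<Rightarrow> nat \<Rightarrow> real" where
  "singular_value a = eigval (op_abs a)"

context
  assumes inf: "\<nexists>B :: 'h::complex_hilbert_space set. finite B \<and> cvec.span B = UNIV"
begin

text \<open>From a*a e_i = l_i e_i the vectors a e_i are pairwise orthogonal of length sqrt l_i,
  which gives h after normalisation. A vector orthogonal to all e_i is killed by a since |a y|^2 =
  <a*a y, y>. The square root shares the vectors e.\<close>

lemma op_abs_eigensystem:
  fixes a :: "'h op"
  assumes a: "a \<in> compact_ops"
  obtains e h s where "singular_system e h s a" "eigensystem e s (op_abs a)"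
proof -
  note ab = compact_ops_bounded[OF a]
  define t where "t = adj a o\<^sub>L a"
  have tc: "t \<in> compact_ops"
    unfolding t_def by (rule compact_ops_compose_left[OF a adj_in_bounded_ops[OF ab]])
  have t_left: "cinner (blinfun_apply t x) y = cinner (blinfun_apply a x) (blinfun_apply a y)" for x y
    by (simp add: t_def cinner_adj_left[OF ab])
  have t_right: "cinner x (blinfun_apply t y) = cinner (blinfun_apply a x) (blinfun_apply a y)" for x y
    by (simp add: t_def cinner_adj_right[OF ab])
  obtain e l where el: "eigensystem e l t"
    by (rule compact_spectral_theorem[OF tc _ _ inf]) (simp_all add: t_left t_right cinner_ge_zero)
  note e = eigensystem_orthonormal[OF el] and nn = eigensystem_nonneg[OF el]
  define s where "s i = sqrt (l i)" for i
  \<comment> \<open>Division by zero yields h_i = 0 where s_i = 0; there a e_i = 0 as well.\<close>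
  define h where "h i = (1 / s i) *\<^sub>R blinfun_apply a (e i)" for i
  have inner: "cinner (blinfun_apply a (e i)) (blinfun_apply a (e j)) = (if i = j then complex_of_real (l i) else 0)" for i j
    by (simp add: t_left[symmetric] eigensystem_apply[OF el] cinner.scaleR_left orthonormal_cinner[OF e] scaleR_conv_of_real)
  have norm_ae: "norm (blinfun_apply a (e i)) = s i" for i
    using inner[of i i] nn[of i] by (simp add: s_def norm_eq_sqrt_cinner)
  have s_nn: "0 \<le> s i" for i by (simp add: s_def nn)
  have "singular_system e h s a"
    unfolding singular_system_def
  proof (intro conjI allI impI)
    show "decseq s" using eigensystem_decseq[OF el] by (simp add: s_def decseq_def)
    show ae: "blinfun_apply a (e i) = s i *\<^sub>R h i" for i
      using norm_ae[of i] by (cases "s i = 0") (auto simp: h_def)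
    show "norm (h i) = 1" if "s i \<noteq> 0" for i
      using that s_nn[of i] by (simp add: h_def norm_ae)
    show "bessel h"
    proof (rule bessel_orthogonal)
      show "cinner (h i) (h j) = 0" if "i \<noteq> j" for i j
        using inner[of i j] that by (simp add: h_def cinner.scaleR_left cinner.scaleR_right)
      show "norm (h i) \<le> 1" for i using s_nn[of i] by (simp add: h_def norm_ae)
    qed
    show "blinfun_apply a y = 0" if y: "\<forall>i. cinner y (e i) = 0" for y
    proof -
      have "blinfun_apply t y = 0" using eigensystem_perp[OF el, of y] y by simp
      then have "cinner (blinfun_apply a y) (blinfun_apply a y) = 0"
        by (simp add: t_left[symmetric] cinner.zero_left)
      then show ?thesis by (simp add: cinner_eq_zero_iff)
    qed
  qed (use ab e s_nn in auto)
  moreover have "eigensystem e s (op_abs a)"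
    using eigensystem_op_powr[OF el, of "1/2"] nn
    by (simp add: op_abs_def t_def s_def[abs_def] powr_half_sqrt)
  ultimately show ?thesis by (rule that)
qed

context
  fixes a :: "'h op"
  assumes a: "a \<in> compact_ops"
begin

lemma singular_value_system:
  obtains e h where "singular_system e h (singular_value a) a"
  using op_abs_eigensystem[OF a] eigensystem_eigval unfolding singular_value_def by metis

lemma eigval_op_powr_op_abs:
  assumes "0 < p"
  shows "eigval (op_powr (op_abs a) p) i = singular_value a i powr p"
proof -
  obtain e h s where "eigensystem e s (op_abs a)" using op_abs_eigensystem[OF a] .
  from eigensystem_eigval[OF eigensystem_op_powr[OF this assms]] eigensystem_eigval[OF this]
  show ?thesis by (simp add: singular_value_def)
qed

lemma singular_value_decseq: "decseq (singular_value a)"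
  and singular_value_nonneg: "0 \<le> singular_value a i"
  using singular_value_system by (auto simp: singular_system_def)

lemma singular_value_tendsto: "singular_value a \<longlonglongrightarrow> 0"
  using op_abs_eigensystem[OF a] eigensystem_eigval eigensystem_tendsto unfolding singular_value_def by metis

lemma ky_fan_attained:
  obtains f g where "bessel f" "bessel g"
    "(\<Sum>i<k. cinner (blinfun_apply a (f i)) (g i)) = complex_of_real (\<Sum>i<k. singular_value a i)"
proof -
  obtain e h where "singular_system e h (singular_value a) a" using singular_value_system .
  from singular_system_bessel[OF this] singular_system_sum_eq[OF this] show ?thesis by (rule that)
qed

lemma ky_fan_le:
  assumes "bessel f" "bessel g"
  shows "cmod (\<Sum>i<k. cinner (blinfun_apply a (f i)) (g i)) \<le> (\<Sum>i<k. singular_value a i)"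
proof -
  obtain e h where "singular_system e h (singular_value a) a" using singular_value_system .
  from singular_system_sum_le[OF this assms] show ?thesis .
qed

text \<open>The maximum is attained, so a bound on all pairings bounds the sum. Subadditivity and
  the adjoint and composition estimates are proved through it.\<close>

lemma ky_fan_leI:
  assumes "\<And>f g. bessel f \<Longrightarrow> bessel g \<Longrightarrow> cmod (\<Sum>i<k. cinner (blinfun_apply a (f i)) (g i)) \<le> M"
  shows "(\<Sum>i<k. singular_value a i) \<le> M"
proof -
  obtain f g where fg: "bessel f" "bessel g"
    "(\<Sum>i<k. cinner (blinfun_apply a (f i)) (g i)) = complex_of_real (\<Sum>i<k. singular_value a i)"
    by (rule ky_fan_attained)
  have "0 \<le> (\<Sum>i<k. singular_value a i)" by (intro sum_nonneg singular_value_nonneg)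
  then show ?thesis using assms[OF fg(1,2)] unfolding fg(3) norm_of_real by simp
qed

end

end

section \<open>Comparison of partial sums of singular values\<close>

lemma bessel_single: "norm u \<le> 1 \<Longrightarrow> bessel (\<lambda>i. if i = 0 then u else 0)"
  by (rule bessel_orthogonal) (auto simp: cinner.zero_left cinner.zero_right)

text \<open>Normalising b to a contraction extracts the factor \<open>norm b\<close>; for b = 0 any
  Bessel sequence serves, here g itself.\<close>

lemma bessel_bounded_image:
  assumes g: "bessel g" and b: "b \<in> bounded_ops"
  shows "\<exists>g'. bessel g' \<and> (\<forall>i. blinfun_apply b (g i) = norm b *\<^sub>R g' i)"
proof (cases "b = 0")
  case True
  then show ?thesis using g by (intro exI[of _ g]) auto
next
  case False
  define b' where "b' = (1 / norm b) *\<^sub>R b"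
  have "bessel (\<lambda>i. blinfun_apply b' (g i))"
    using False by (intro bessel_compose[OF g]) (simp_all add: b'_def bounded_ops_scaleR b)
  then show ?thesis
    using False by (intro exI[of _ "\<lambda>i. blinfun_apply b' (g i)"]) (simp_all add: b'_def blinfun.scaleR_left)
qed

lemma op_scaleC_id_norm_le: "norm (op_scaleC c id_blinfun) \<le> cmod c"
  by (rule norm_blinfun_bound) (simp_all add: norm_scaleC)

context
  assumes inf: "\<nexists>B :: 'h::complex_hilbert_space set. finite B \<and> cvec.span B = UNIV"
begin

lemma sum_singular_value_add:
  fixes a b :: "'h op"
  assumes a: "a \<in> compact_ops" and b: "b \<in> compact_ops"
  shows "(\<Sum>i<k. singular_value (a + b) i) \<le> (\<Sum>i<k. singular_value a i) + (\<Sum>i<k. singular_value b i)"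
proof (rule ky_fan_leI[OF inf compact_ops_add[OF a b]])
  fix f g :: "nat \<Rightarrow> 'h" assume fg: "bessel f" "bessel g"
  have "cmod (\<Sum>i<k. cinner (blinfun_apply (a + b) (f i)) (g i)) =
      cmod ((\<Sum>i<k. cinner (blinfun_apply a (f i)) (g i)) + (\<Sum>i<k. cinner (blinfun_apply b (f i)) (g i)))"
    by (simp add: blinfun.add_left cinner.add_left sum.distrib)
  also have "\<dots> \<le> (\<Sum>i<k. singular_value a i) + (\<Sum>i<k. singular_value b i)"
    by (intro order_trans[OF norm_triangle_ineq] add_mono ky_fan_le[OF inf] a b fg)
  finally show "cmod (\<Sum>i<k. cinner (blinfun_apply (a + b) (f i)) (g i)) \<le> \<dots>" .
qed

context
  fixes a :: "'h op"
  assumes a: "a \<in> compact_ops"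
begin

text \<open>In <b a f_i, g_i> the factor b moves to g_i as its adjoint, leaving an admissible
  pairing for a.\<close>

lemma sum_singular_value_compose_left:
  assumes b: "b \<in> bounded_ops"
  shows "(\<Sum>i<k. singular_value (b o\<^sub>L a) i) \<le> norm b * (\<Sum>i<k. singular_value a i)"
proof (rule ky_fan_leI[OF inf compact_ops_compose_left[OF a b]])
  fix f g :: "nat \<Rightarrow> 'h" assume f: "bessel f" and g: "bessel g"
  obtain g' where g': "bessel g'" "\<And>i. blinfun_apply (adj b) (g i) = norm (adj b) *\<^sub>R g' i"
    using bessel_bounded_image[OF g adj_in_bounded_ops[OF b]] by blast
  have "(\<Sum>i<k. cinner (blinfun_apply (b o\<^sub>L a) (f i)) (g i)) =
      norm (adj b) *\<^sub>R (\<Sum>i<k. cinner (blinfun_apply a (f i)) (g' i))"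
    by (simp only: blinfun_apply_blinfun_compose cinner_adj_right[OF b, symmetric] g'(2)
        cinner.scaleR_right scaleR_sum_right)
  then have "cmod (\<Sum>i<k. cinner (blinfun_apply (b o\<^sub>L a) (f i)) (g i)) =
      norm (adj b) * cmod (\<Sum>i<k. cinner (blinfun_apply a (f i)) (g' i))"
    by simp
  also have "\<dots> \<le> norm b * (\<Sum>i<k. singular_value a i)"
    by (intro mult_mono norm_adj_le[OF b] ky_fan_le[OF inf a f g'(1)]) auto
  finally show "cmod (\<Sum>i<k. cinner (blinfun_apply (b o\<^sub>L a) (f i)) (g i)) \<le> \<dots>" .
qed

lemma sum_singular_value_compose_right:
  assumes b: "b \<in> bounded_ops"
  shows "(\<Sum>i<k. singular_value (a o\<^sub>L b) i) \<le> norm b * (\<Sum>i<k. singular_value a i)"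
proof (rule ky_fan_leI[OF inf compact_ops_compose_right[OF a b]])
  fix f g :: "nat \<Rightarrow> 'h" assume f: "bessel f" and g: "bessel g"
  obtain f' where f': "bessel f'" "\<And>i. blinfun_apply b (f i) = norm b *\<^sub>R f' i"
    using bessel_bounded_image[OF f b] by blast
  have "(\<Sum>i<k. cinner (blinfun_apply (a o\<^sub>L b) (f i)) (g i)) =
      norm b *\<^sub>R (\<Sum>i<k. cinner (blinfun_apply a (f' i)) (g i))"
    by (simp only: blinfun_apply_blinfun_compose f'(2) blinfun.scaleR_right
        cinner.scaleR_left scaleR_sum_right)
  then have "cmod (\<Sum>i<k. cinner (blinfun_apply (a o\<^sub>L b) (f i)) (g i)) =
      norm b * cmod (\<Sum>i<k. cinner (blinfun_apply a (f' i)) (g i))"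
    by simp
  also have "\<dots> \<le> norm b * (\<Sum>i<k. singular_value a i)"
    by (intro mult_left_mono ky_fan_le[OF inf a f'(1) g]) simp
  finally show "cmod (\<Sum>i<k. cinner (blinfun_apply (a o\<^sub>L b) (f i)) (g i)) \<le> \<dots>" .
qed

lemma sum_singular_value_scaleC:
  "(\<Sum>i<k. singular_value (op_scaleC c a) i) \<le> cmod c * (\<Sum>i<k. singular_value a i)"
proof -
  have "(\<Sum>i<k. singular_value (op_scaleC c a) i) \<le> norm (op_scaleC c (id_blinfun :: 'h op)) * (\<Sum>i<k. singular_value a i)"
    by (subst op_scaleC_eq_compose) (simp add: sum_singular_value_compose_left bounded_ops_scaleC)
  also have "\<dots> \<le> cmod c * (\<Sum>i<k. singular_value a i)"
    by (intro mult_right_mono op_scaleC_id_norm_le sum_nonneg singular_value_nonneg[OF inf a])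
  finally show ?thesis .
qed

text \<open>Passing to the adjoint exchanges the roles of f and g up to conjugation.\<close>

lemma sum_singular_value_adj:
  "(\<Sum>i<k. singular_value (adj a) i) \<le> (\<Sum>i<k. singular_value a i)"
proof (rule ky_fan_leI[OF inf compact_ops_adj[OF a]])
  fix f g :: "nat \<Rightarrow> 'h" assume f: "bessel f" and g: "bessel g"
  have "(\<Sum>i<k. cinner (blinfun_apply (adj a) (f i)) (g i)) = (\<Sum>i<k. cnj (cinner (blinfun_apply a (g i)) (f i)))"
    by (simp add: cinner_adj_left[OF compact_ops_bounded[OF a]] flip: cinner_commute)
  then have "cmod (\<Sum>i<k. cinner (blinfun_apply (adj a) (f i)) (g i)) = cmod (\<Sum>i<k. cinner (blinfun_apply a (g i)) (f i))"
    by (metis cnj_sum complex_mod_cnj)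
  also have "\<dots> \<le> (\<Sum>i<k. singular_value a i)" by (rule ky_fan_le[OF inf a g f])
  finally show "cmod (\<Sum>i<k. cinner (blinfun_apply (adj a) (f i)) (g i)) \<le> \<dots>" .
qed

lemma sum_singular_value_le_norm: "(\<Sum>i<k. singular_value a i) \<le> real k * norm a"
proof (rule ky_fan_leI[OF inf a])
  fix f g :: "nat \<Rightarrow> 'h" assume f: "bessel f" and g: "bessel g"
  have "cmod (cinner (blinfun_apply a (f i)) (g i)) \<le> norm a" for i
  proof -
    have "cmod (cinner (blinfun_apply a (f i)) (g i)) \<le> norm (blinfun_apply a (f i)) * norm (g i)"
      by (rule cauchy_schwarz)
    also have "\<dots> \<le> (norm a * norm (f i)) * norm (g i)" by (intro mult_right_mono norm_blinfun) simp
    also have "\<dots> \<le> norm a * 1 * 1"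
      by (intro mult_mono bessel_norm_le f g) auto
    finally show ?thesis by simp
  qed
  then have "(\<Sum>i<k. cmod (cinner (blinfun_apply a (f i)) (g i))) \<le> (\<Sum>i<k. norm a)" by (rule sum_mono)
  then show "cmod (\<Sum>i<k. cinner (blinfun_apply a (f i)) (g i)) \<le> real k * norm a"
    by (intro order_trans[OF norm_sum]) simp
qed

text \<open>The case k = 1 of the maximum principle, tested on the unit vectors in the directions of
  x and a x.\<close>

lemma norm_le_singular_value: "norm a \<le> singular_value a 0"
proof (rule norm_blinfun_bound)
  show "0 \<le> singular_value a 0" by (rule singular_value_nonneg[OF inf a])
  fix x
  show "norm (blinfun_apply a x) \<le> singular_value a 0 * norm x"
  proof (cases "blinfun_apply a x = 0")
    case True
    then show ?thesis by (simp add: singular_value_nonneg[OF inf a])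
  next
    case False
    then have x: "x \<noteq> 0" by auto
    let ?y = "blinfun_apply a x"
    define u where "u = (1 / norm x) *\<^sub>R x"
    define v where "v = (1 / norm ?y) *\<^sub>R ?y"
    have "cinner (blinfun_apply a u) v = complex_of_real (norm ?y / norm x)"
      using False x unfolding u_def v_def
      by (simp add: blinfun.scaleR_right cinner.scaleR_left cinner.scaleR_right cinner_self
          scaleR_conv_of_real power2_eq_square)
    moreover have "norm u \<le> 1" "norm v \<le> 1" by (simp_all add: u_def v_def)
    ultimately have "norm ?y / norm x \<le> singular_value a 0"
      using ky_fan_le[OF inf a bessel_single[of u] bessel_single[of v], of 1] by (simp add: norm_divide)
    then show ?thesis using x by (simp add: field_simps)
  qed
qed

end

text \<open>The k-th partial sum is subadditive and at most k times the norm, hence Lipschitz with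
  constant k. A single singular value is the difference of two consecutive partial sums.\<close>

lemma singular_value_LIMSEQ:
  fixes s :: "nat \<Rightarrow> 'h op"
  assumes s: "\<And>n. s n \<in> compact_ops" and a: "a \<in> compact_ops" and lim: "s \<longlonglongrightarrow> a"
  shows "(\<lambda>n. singular_value (s n) i) \<longlonglongrightarrow> singular_value a i"
proof -
  have le: "(\<Sum>i<k. singular_value b i) - (\<Sum>i<k. singular_value c i) \<le> real k * norm (b - c)"
    if "b \<in> compact_ops" "c \<in> compact_ops" for b c :: "'h op" and k
    using sum_singular_value_add[OF that(2) compact_ops_diff[OF that], of k]
      sum_singular_value_le_norm[OF compact_ops_diff[OF that], of k] by simp
  have "(\<lambda>n. (\<Sum>i<k. singular_value (s n) i)) \<longlonglongrightarrow> (\<Sum>i<k. singular_value a i)" for k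
  proof (rule LIM_zero_cancel, rule Lim_null_comparison)
    have "\<bar>(\<Sum>i<k. singular_value (s n) i) - (\<Sum>i<k. singular_value a i)\<bar> \<le> real k * norm (s n - a)" for n
      using le[OF s a, of n k] le[OF a s, of k n] by (simp add: abs_le_iff norm_minus_commute)
    then show "\<forall>\<^sub>F n in sequentially. norm ((\<Sum>i<k. singular_value (s n) i) - (\<Sum>i<k. singular_value a i)) \<le> real k * norm (s n - a)"
      by simp
    show "(\<lambda>n. real k * norm (s n - a)) \<longlonglongrightarrow> 0"
      using lim by (intro tendsto_mult_right_zero tendsto_norm_zero LIM_zero)
  qed
  from tendsto_diff[OF this[of "Suc i"] this[of i]] show ?thesis by simp
qed

end


section \<open>Weighted norms of decreasing sequences\<close>

lemma sum_decseq_weights_mono: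
  fixes v d :: "nat \<Rightarrow> real"
  assumes v: "decseq v" "\<And>i. 0 \<le> v i" and d: "\<And>k. 0 \<le> (\<Sum>i<k. d i)"
  shows "0 \<le> (\<Sum>i<n. v i * d i)"
proof -
  \<comment> \<open>Abel summation as an induction; the stronger left-hand side absorbs each
    decrease of v.\<close>
  have "v n * (\<Sum>i<n. d i) \<le> (\<Sum>i<n. v i * d i)"
  proof (induction n)
    case (Suc n)
    have "v (Suc n) * (\<Sum>i<Suc n. d i) \<le> v n * (\<Sum>i<Suc n. d i)"
      by (intro mult_right_mono d decseqD[OF v(1)]) simp
    also have "\<dots> \<le> (\<Sum>i<Suc n. v i * d i)" using Suc.IH by (simp add: algebra_simps)
    finally show ?case .
  qed simp
  moreover have "0 \<le> v n * (\<Sum>i<n. d i)" by (intro mult_nonneg_nonneg v d)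
  ultimately show ?thesis by linarith
qed

text \<open>Young's inequality for the exponents p/(p-1) and p, in a form that also makes sense at p
  = 1. Zero arguments are split off; in Isabelle \<open>0 powr 0 = 0\<close>, so the left side
  vanishes there.\<close>

lemma young_powr:
  fixes x y p :: real
  assumes "1 \<le> p" "0 \<le> x" "0 \<le> y"
  shows "x powr (p - 1) * y \<le> (p - 1) / p * x powr p + 1 / p * y powr p"
proof (cases "x = 0 \<or> y = 0")
  case True
  then show ?thesis using assms by auto
next
  case False
  then have "(x powr p) powr ((p - 1) / p) * (y powr p) powr (1 / p) \<le> (p - 1) / p * x powr p + 1 / p * y powr p"
    using assms by (intro Youngs_inequality_0) (simp_all add: field_simps)
  then show ?thesis using False assms by (simp add: powr_powr)
qed

locale concave_weight =
  fixes \<alpha> :: "nat \<Rightarrow> real" and p :: real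
  assumes p: "1 \<le> p" and mono: "mono \<alpha>" and zero: "\<alpha> 0 = 0" and pos: "0 < \<alpha> 1"
    and concave: "\<And>i. 1 \<le> i \<Longrightarrow> (\<alpha> (i + 1) + \<alpha> (i - 1)) / 2 \<le> \<alpha> i"
begin

definition weight :: "nat \<Rightarrow> real" where
  "weight i = \<alpha> (Suc i) - \<alpha> i"

lemma weight_nonneg: "0 \<le> weight i"
  using monoD[OF mono, of i "Suc i"] by (simp add: weight_def)

lemma decseq_weight: "decseq weight"
proof (rule decseq_SucI)
  fix i show "weight (Suc i) \<le> weight i"
    using concave[of "Suc i"] by (simp add: weight_def field_simps)
qed

lemma weight_0_pos: "0 < weight 0"
  using pos zero by (simp add: weight_def)

text \<open>A truncation, so that limits and inequalities concern finite sums; the Schatten norm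
  becomes the least common bound of all \<open>wnorm n\<close>.\<close>

definition wsum :: "nat \<Rightarrow> (nat \<Rightarrow> real) \<Rightarrow> real" where
  "wsum n x = (\<Sum>i<n. weight i * x i powr p)"

definition wnorm :: "nat \<Rightarrow> (nat \<Rightarrow> real) \<Rightarrow> real" where
  "wnorm n x = wsum n x powr (1 / p)"

lemma wsum_nonneg: "0 \<le> wsum n x"
  unfolding wsum_def by (intro sum_nonneg mult_nonneg_nonneg weight_nonneg) simp

lemma wnorm_nonneg: "0 \<le> wnorm n x"
  by (simp add: wnorm_def)

lemma wnorm_powr: "wnorm n x powr p = wsum n x"
  using p wsum_nonneg by (simp add: wnorm_def powr_powr)

lemma wnorm_le_iff: "0 \<le> M \<Longrightarrow> wnorm n x \<le> M \<longleftrightarrow> wsum n x \<le> M powr p"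
proof
  assume M: "0 \<le> M"
  show "wsum n x \<le> M powr p" if "wnorm n x \<le> M"
    using powr_mono2[OF _ wnorm_nonneg that, of p] p by (simp add: wnorm_powr)
  show "wnorm n x \<le> M" if "wsum n x \<le> M powr p"
    using powr_mono2[OF _ wsum_nonneg that, of "1 / p"] p M by (simp add: wnorm_def powr_powr)
qed

lemma wnorm_zero: "wnorm n (\<lambda>i. 0) = 0"
  by (simp add: wnorm_def wsum_def)

lemma wnorm_scale:
  assumes "0 \<le> c" "\<And>i. 0 \<le> x i"
  shows "wnorm n (\<lambda>i. c * x i) = c * wnorm n x"
proof -
  have "wsum n (\<lambda>i. c * x i) = c powr p * wsum n x"
    using assms by (simp add: wsum_def powr_mult sum_distrib_left mult_ac)
  then show ?thesis
    using assms p wsum_nonneg by (simp add: wnorm_def powr_mult powr_powr)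
qed

text \<open>Both sequences are normalised to norm 1 and Young's inequality is summed; the
  coefficients (p-1)/p and 1/p add up to 1.\<close>

lemma weighted_holder:
  assumes x: "\<And>i. 0 \<le> x i" and y: "\<And>i. 0 \<le> y i"
  shows "(\<Sum>i<n. weight i * x i powr (p - 1) * y i) \<le> wnorm n x powr (p - 1) * wnorm n y"
proof (cases "wnorm n x = 0 \<or> wnorm n y = 0")
  case True
  then have "wsum n x = 0 \<or> wsum n y = 0"
    using wnorm_powr[of n x] wnorm_powr[of n y] by force
  \<comment> \<open>Weights may vanish, so only the products are known to be zero; that
    suffices.\<close>
  then have "(\<forall>i<n. weight i * x i powr p = 0) \<or> (\<forall>i<n. weight i * y i powr p = 0)"
    unfolding wsum_def by (subst (asm) (1 2) sum_nonneg_eq_0_iff) (auto simp: weight_nonneg)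
  then have "(\<Sum>i<n. weight i * x i powr (p - 1) * y i) = 0"
    by (intro sum.neutral) auto
  then show ?thesis using wnorm_nonneg[of n y] by simp
next
  case False
  define A where "A = wnorm n x"
  define B where "B = wnorm n y"
  have A: "0 < A" and B: "0 < B"
    using False wnorm_nonneg[of n x] wnorm_nonneg[of n y] by (auto simp: A_def B_def)
  have "(\<Sum>i<n. weight i * ((x i / A) powr (p - 1) * (y i / B)))
      \<le> (\<Sum>i<n. weight i * ((p - 1) / p * (x i / A) powr p + 1 / p * (y i / B) powr p))"
    using A B x y p by (intro sum_mono mult_left_mono young_powr weight_nonneg) auto
  also have "\<dots> = (p - 1) / p * (wsum n x / A powr p) + 1 / p * (wsum n y / B powr p)"
    using A B x y by (simp add: wsum_def powr_divide sum.distrib sum_distrib_left sum_divide_distrib algebra_simps)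
  also have "\<dots> = (p - 1) / p + 1 / p"
    using A B wnorm_powr[of n x, symmetric] wnorm_powr[of n y, symmetric] by (simp add: A_def B_def)
  also have "\<dots> = 1" using p by (simp add: field_simps)
  finally have le: "(\<Sum>i<n. weight i * ((x i / A) powr (p - 1) * (y i / B))) \<le> 1" .
  have "(\<Sum>i<n. weight i * x i powr (p - 1) * y i) =
      A powr (p - 1) * B * (\<Sum>i<n. weight i * ((x i / A) powr (p - 1) * (y i / B)))"
    using A B x unfolding sum_distrib_left by (intro sum.cong) (simp_all add: powr_divide field_simps)
  also have "\<dots> \<le> A powr (p - 1) * B * 1"
    using B by (intro mult_left_mono le) simp
  finally show ?thesis by (simp add: A_def B_def)
qed

text \<open>The weights \<open>v\<^sub>i = w\<^sub>i x\<^sub>i\<^sup>p\<^sup>-\<^sup>1\<close> decrease, so summation by parts turns the domination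
  of partial sums into \<open>\<Sum> v\<^sub>i x\<^sub>i \<le> \<Sum> v\<^sub>i (y\<^sub>i + z\<^sub>i)\<close>; apply Hoelder to the right-hand side.\<close>

lemma wnorm_triangle:
  assumes dec: "decseq x" and x: "\<And>i. 0 \<le> x i" and y: "\<And>i. 0 \<le> y i" and z: "\<And>i. 0 \<le> z i"
    and le: "\<And>k. (\<Sum>i<k. x i) \<le> (\<Sum>i<k. y i) + (\<Sum>i<k. z i)"
  shows "wnorm n x \<le> wnorm n y + wnorm n z"
proof (cases "wnorm n x = 0")
  case True
  then show ?thesis using wnorm_nonneg by simp
next
  case False
  define A where "A = wnorm n x"
  have A: "0 < A" using False wnorm_nonneg[of n x] by (simp add: A_def)
  define v where "v i = weight i * x i powr (p - 1)" for i
  have v: "decseq v"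
    unfolding v_def decseq_def
    using decseqD[OF dec] decseqD[OF decseq_weight] x weight_nonneg p
    by (auto intro!: mult_mono powr_mono2)
  have "0 \<le> (\<Sum>i<n. v i * (y i + z i - x i))"
    using le by (intro sum_decseq_weights_mono v)
      (simp_all add: v_def weight_nonneg sum.distrib sum_subtractf)
  then have "(\<Sum>i<n. v i * x i) \<le> (\<Sum>i<n. v i * y i) + (\<Sum>i<n. v i * z i)"
    by (simp add: sum.distrib sum_subtractf algebra_simps)
  also have "\<dots> \<le> A powr (p - 1) * wnorm n y + A powr (p - 1) * wnorm n z"
    unfolding v_def A_def by (intro add_mono weighted_holder x y z)
  also have "(\<Sum>i<n. v i * x i) = wsum n x"
    unfolding v_def wsum_def
  proof (rule sum.cong[OF refl])
    fix i show "weight i * x i powr (p - 1) * x i = weight i * x i powr p"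
      using powr_mult_base[OF x[of i], of "p - 1"] by (simp add: mult_ac)
  qed
  also have "wsum n x = A powr (p - 1) * A"
    using wnorm_powr[of n x] powr_mult_base[of A "p - 1"] A by (simp add: A_def mult.commute)
  finally have "A powr (p - 1) * A \<le> A powr (p - 1) * (wnorm n y + wnorm n z)"
    by (simp add: distrib_left)
  then show ?thesis using A by (simp add: A_def)
qed

lemma wnorm_1: "0 \<le> x 0 \<Longrightarrow> wnorm 1 x = weight 0 powr (1 / p) * x 0"
  using p weight_0_pos by (simp add: wnorm_def wsum_def powr_mult powr_powr)

lemma wnorm_tendsto:
  assumes "\<And>i. (\<lambda>m. s m i) \<longlonglongrightarrow> x i" "\<And>m i. 0 \<le> s m i"
  shows "(\<lambda>m. wnorm n (s m)) \<longlonglongrightarrow> wnorm n x"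
  unfolding wnorm_def wsum_def
  using p assms
  by (intro tendsto_powr2 tendsto_sum tendsto_mult tendsto_const eventuallyI always_eventually allI
      sum_nonneg mult_nonneg_nonneg weight_nonneg) auto

text \<open>Summation by parts gives \<open>\<Sum>\<^bsub>i<n\<^esub> (t\<^sub>i - t\<^sub>i\<^sub>+\<^sub>1) \<alpha>(i+1) = \<Sum>\<^bsub>i<n\<^esub> w\<^sub>i (t\<^sub>i - t\<^sub>n)\<close>; since
  \<open>t\<^sub>n \<rightarrow> 0\<close> monotonically, both sides have the same supremum as \<open>\<Sum>\<^bsub>i<n\<^esub> w\<^sub>i t\<^sub>i\<close>.\<close>

lemma choquet_partial_sums_le_iff:
  assumes dec: "decseq t" and nn: "\<And>i. 0 \<le> t i" and lim: "t \<longlonglongrightarrow> 0"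
  shows "(\<forall>n. (\<Sum>i<n. (t i - t (Suc i)) * \<alpha> (Suc i)) \<le> M) \<longleftrightarrow> (\<forall>n. (\<Sum>i<n. weight i * t i) \<le> M)"
proof -
  have abel: "(\<Sum>i<n. (t i - t (Suc i)) * \<alpha> (Suc i)) = (\<Sum>i<n. weight i * t i) - t n * \<alpha> n" for n
    by (induction n) (simp_all add: zero weight_def algebra_simps)
  have alpha: "\<alpha> n = (\<Sum>i<n. weight i)" for n
    by (induction n) (simp_all add: zero weight_def)
  have \<alpha>_nn: "0 \<le> \<alpha> n" for n using monoD[OF mono, of 0 n] zero by simp
  show ?thesis
  proof (intro iffI allI)
    fix n assume le: "\<forall>n. (\<Sum>i<n. weight i * t i) \<le> M"
    show "(\<Sum>i<n. (t i - t (Suc i)) * \<alpha> (Suc i)) \<le> M"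
      using le[rule_format, of n] mult_nonneg_nonneg[OF nn[of n] \<alpha>_nn[of n]] by (simp add: abel)
  next
    fix m assume le: "\<forall>n. (\<Sum>i<n. (t i - t (Suc i)) * \<alpha> (Suc i)) \<le> M"
    \<comment> \<open>Extending the sum from m to n adds nonnegative terms; afterwards n tends to
      infinity with m fixed.\<close>
    have "(\<Sum>i<m. weight i * (t i - t n)) \<le> M" if "m \<le> n" for n
    proof -
      have "(\<Sum>i<m. weight i * (t i - t n)) \<le> (\<Sum>i<n. weight i * (t i - t n))"
        using that decseqD[OF dec] weight_nonneg by (intro sum_mono2) auto
      also have "\<dots> = (\<Sum>i<n. weight i * t i) - t n * \<alpha> n"
        by (simp add: alpha right_diff_distrib sum_subtractf sum_distrib_left mult.commute)
      also have "\<dots> \<le> M" using le by (simp add: abel)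
      finally show ?thesis .
    qed
    moreover have "(\<lambda>n. \<Sum>i<m. weight i * (t i - t n)) \<longlonglongrightarrow> (\<Sum>i<m. weight i * (t i - 0))"
      by (intro tendsto_intros lim)
    ultimately have "(\<Sum>i<m. weight i * (t i - 0)) \<le> M"
      by (intro LIMSEQ_le_const2) auto
    then show "(\<Sum>i<m. weight i * t i) \<le> M" by simp
  qed
qed

end


section \<open>The weighted Schatten class\<close>

context concave_weight
begin

context
  assumes inf: "\<nexists>B :: 'h::complex_hilbert_space set. finite B \<and> cvec.span B = UNIV"
begin

abbreviation (input) C :: "'h op set" where
  "C \<equiv> schatten_class \<alpha> p"

abbreviation (input) N :: "'h op \<Rightarrow> real" where
  "N a \<equiv> enn2real (schatten_norm \<alpha> p a)"

text \<open>Stated through upper bounds, so that it applies before the trace is known to be finite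
  and decides finiteness itself.\<close>

lemma choquet_trace_le_iff:
  fixes a :: "'h op"
  assumes a: "a \<in> compact_ops" and M: "0 \<le> M"
  shows "choquet_trace \<alpha> (op_powr (op_abs a) p) \<le> ennreal M \<longleftrightarrow> (\<forall>n. wsum n (singular_value a) \<le> M)"
proof -
  define t where "t i = singular_value a i powr p" for i
  have nn: "0 \<le> t i" for i by (simp add: t_def)
  have dec: "decseq t"
    using decseqD[OF singular_value_decseq[OF inf a]] singular_value_nonneg[OF inf a] p
    by (auto simp: t_def decseq_def intro!: powr_mono2)
  have lim: "t \<longlonglongrightarrow> 0"
    using tendsto_powr2[OF singular_value_tendsto[OF inf a] tendsto_const, of p]
      singular_value_nonneg[OF inf a] p by (simp add: t_def[abs_def])
  define f where "f i = (t i - t (Suc i)) * \<alpha> (Suc i)" for i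
  have f: "0 \<le> f i" for i
    using decseqD[OF dec, of i "Suc i"] monoD[OF mono, of 0 "Suc i"] zero by (simp add: f_def)
  have eig: "eigval (op_powr (op_abs a) p) = t"
    using eigval_op_powr_op_abs[OF inf a] p by (auto simp: t_def)
  have ch: "choquet_trace \<alpha> (op_powr (op_abs a) p) = (\<Sum>i. ennreal (f i))"
    by (simp add: choquet_trace_def eig f_def)
  have part: "(\<Sum>i<n. ennreal (f i)) = ennreal (\<Sum>i<n. f i)" for n
    using f by (simp add: sum_ennreal)
  have "(\<Sum>i. ennreal (f i)) \<le> ennreal M \<longleftrightarrow> (\<forall>n. (\<Sum>i<n. f i) \<le> M)"
  proof
    assume le: "(\<Sum>i. ennreal (f i)) \<le> ennreal M"
    have "ennreal (\<Sum>i<n. f i) \<le> ennreal M" for n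
      unfolding part[symmetric] by (rule order_trans[OF sum_le_suminf le]) auto
    then show "\<forall>n. (\<Sum>i<n. f i) \<le> M" using M by (simp add: ennreal_le_iff)
  next
    assume "\<forall>n. (\<Sum>i<n. f i) \<le> M"
    then show "(\<Sum>i. ennreal (f i)) \<le> ennreal M"
      by (intro suminf_le_const summableI) (simp add: part ennreal_leI)
  qed
  also have "\<dots> \<longleftrightarrow> (\<forall>n. wsum n (singular_value a) \<le> M)"
    using choquet_partial_sums_le_iff[OF dec nn lim, of M] by (simp add: f_def wsum_def t_def)
  finally show ?thesis unfolding ch .
qed

lemma schatten_class_compact: "a \<in> C \<Longrightarrow> a \<in> compact_ops"
  by (simp add: schatten_class_def)

text \<open>Together with \<open>wnorm_le_schatten_norm\<close> this characterises the norm as the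
  least bound of the truncated norms; later arguments use only these two facts about the
  trace.\<close>

lemma schatten_classI:
  fixes a :: "'h op"
  assumes a: "a \<in> compact_ops" and M: "0 \<le> M" and le: "\<And>n. wnorm n (singular_value a) \<le> M"
  shows "a \<in> C" "N a \<le> M"
proof -
  define s where "s = choquet_trace \<alpha> (op_powr (op_abs a) p)"
  have s: "s \<le> ennreal (M powr p)"
    unfolding s_def choquet_trace_le_iff[OF a powr_ge_zero]
    using le by (simp add: wnorm_le_iff[OF M, symmetric])
  then have fin: "s \<noteq> \<infinity>" by (auto simp: top_unique)
  have sn: "schatten_norm \<alpha> p a = ennreal (enn2real s powr (1 / p))"
    using fin by (simp add: schatten_norm_def s_def[symmetric] Let_def)
  then show "a \<in> C" using a by (simp add: schatten_class_def)
  have "enn2real s powr (1 / p) \<le> (M powr p) powr (1 / p)"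
    using p s by (intro powr_mono2 enn2real_leI) auto
  then show "N a \<le> M" using M p by (simp add: sn powr_powr)
qed

lemma wnorm_le_schatten_norm:
  fixes a :: "'h op"
  assumes "a \<in> C"
  shows "wnorm n (singular_value a) \<le> N a"
proof -
  note a = schatten_class_compact[OF assms]
  define s where "s = choquet_trace \<alpha> (op_powr (op_abs a) p)"
  have fin: "s \<noteq> \<infinity>"
    using assms by (auto simp: schatten_class_def schatten_norm_def s_def Let_def)
  then have s: "s = ennreal (enn2real s)" by (simp add: less_top)
  then have "wsum n (singular_value a) \<le> enn2real s"
    using choquet_trace_le_iff[OF a, of "enn2real s"] unfolding s_def[symmetric] by simp
  then have "wnorm n (singular_value a) \<le> enn2real s powr (1 / p)"
    unfolding wnorm_def using p by (intro powr_mono2 wsum_nonneg) auto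
  then show ?thesis using fin by (simp add: schatten_norm_def s_def[symmetric] Let_def)
qed

text \<open>The triangle estimate with zero as second summand. Scalars, adjoints and both
  compositions are instances, with c = |c|, 1 and \<open>norm b\<close>.\<close>

lemma schatten_dominated:
  fixes a b :: "'h op"
  assumes a: "a \<in> compact_ops" and b: "b \<in> C" and c: "0 \<le> c"
    and le: "\<And>k. (\<Sum>i<k. singular_value a i) \<le> c * (\<Sum>i<k. singular_value b i)"
  shows "a \<in> C" "N a \<le> c * N b"
proof -
  note nn = singular_value_nonneg[OF inf schatten_class_compact[OF b]]
  have "wnorm n (singular_value a) \<le> c * N b" for n
  proof -
    have "wnorm n (singular_value a) \<le> wnorm n (\<lambda>i. c * singular_value b i) + wnorm n (\<lambda>i. 0)"
      using le c nn
      by (intro wnorm_triangle singular_value_decseq[OF inf a] singular_value_nonneg[OF inf a])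
        (simp_all add: sum_distrib_left)
    also have "\<dots> = c * wnorm n (singular_value b)" by (simp add: wnorm_scale c nn wnorm_zero)
    also have "\<dots> \<le> c * N b" by (intro mult_left_mono wnorm_le_schatten_norm b c)
    finally show ?thesis .
  qed
  then show "a \<in> C" "N a \<le> c * N b"
    using schatten_classI[OF a, of "c * N b"] c by simp_all
qed

section \<open>Vector space operations, norm axioms and completeness\<close>

lemma schatten_add:
  fixes a b :: "'h op"
  assumes a: "a \<in> C" and b: "b \<in> C"
  shows "a + b \<in> C" "N (a + b) \<le> N a + N b"
proof -
  note ac = schatten_class_compact[OF a] and bc = schatten_class_compact[OF b]
  note abc = compact_ops_add[OF ac bc]
  have "wnorm n (singular_value (a + b)) \<le> N a + N b" for n
  proof -
    have "wnorm n (singular_value (a + b)) \<le> wnorm n (singular_value a) + wnorm n (singular_value b)"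
      by (intro wnorm_triangle singular_value_decseq[OF inf abc] singular_value_nonneg[OF inf] abc ac bc
          sum_singular_value_add[OF inf])
    also have "\<dots> \<le> N a + N b" by (intro add_mono wnorm_le_schatten_norm a b)
    finally show ?thesis .
  qed
  then show "a + b \<in> C" "N (a + b) \<le> N a + N b"
    using schatten_classI[OF abc, of "N a + N b"] by simp_all
qed

lemma zero_in_schatten_class: "0 \<in> C"
proof (rule schatten_classI(1)[OF zero_in_compact_ops order_refl])
  have "singular_value (0 :: 'h op) i = 0" for i
  proof -
    note nn = singular_value_nonneg[OF inf zero_in_compact_ops]
    have "singular_value (0 :: 'h op) i \<le> (\<Sum>j<Suc i. singular_value (0 :: 'h op) j)"
      by (rule member_le_sum) (auto simp: nn)
    also have "\<dots> \<le> 0" using sum_singular_value_le_norm[OF inf zero_in_compact_ops, of "Suc i"] by simp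
    finally show ?thesis using nn[of i] by simp
  qed
  then have "singular_value (0 :: 'h op) = (\<lambda>i. 0)" by auto
  then show "wnorm n (singular_value (0 :: 'h op)) \<le> 0" for n by (simp add: wnorm_zero)
qed

lemma schatten_scaleC_le:
  fixes a :: "'h op"
  assumes a: "a \<in> C"
  shows "op_scaleC c a \<in> C" "N (op_scaleC c a) \<le> cmod c * N a"
  using schatten_dominated[OF compact_ops_scaleC[OF schatten_class_compact[OF a]] a, of "cmod c" c]
    sum_singular_value_scaleC[OF inf schatten_class_compact[OF a]] by simp_all

lemma schatten_scaleC:
  fixes a :: "'h op"
  assumes a: "a \<in> C"
  shows "N (op_scaleC c a) = cmod c * N a"
proof (rule antisym)
  show "N (op_scaleC c a) \<le> cmod c * N a" by (rule schatten_scaleC_le(2)[OF a])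
  show "cmod c * N a \<le> N (op_scaleC c a)"
  proof (cases "c = 0")
    case False
    \<comment> \<open>The reverse inequality is the same upper bound for the inverse scalar.\<close>
    then have "N a = N (op_scaleC (inverse c) (op_scaleC c a))" by simp
    also have "\<dots> \<le> cmod (inverse c) * N (op_scaleC c a)"
      by (intro schatten_scaleC_le a)
    finally show ?thesis using False by (simp add: norm_inverse norm_divide field_simps)
  qed simp
qed

lemma schatten_diff:
  fixes a b :: "'h op"
  assumes "a \<in> C" "b \<in> C"
  shows "a - b \<in> C"
  using schatten_add(1)[OF assms(1) schatten_scaleC_le(1)[OF assms(2), of "- 1"]]
  by (simp add: op_scaleC_minus_one)

text \<open>The truncation to one term suffices. \<open>weight 0\<close> equals \<alpha> 1, so its
  positivity gives both definiteness and control of the operator norm.\<close>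

lemma norm_le_schatten_norm:
  fixes a :: "'h op"
  assumes a: "a \<in> C"
  shows "weight 0 powr (1 / p) * norm a \<le> N a"
proof -
  note ac = schatten_class_compact[OF a]
  have "weight 0 powr (1 / p) * norm a \<le> weight 0 powr (1 / p) * singular_value a 0"
    by (intro mult_left_mono norm_le_singular_value[OF inf ac]) simp
  also have "\<dots> \<le> N a"
    using wnorm_le_schatten_norm[OF a, of 1] wnorm_1[of "singular_value a"]
      singular_value_nonneg[OF inf ac, of 0] by simp
  finally show ?thesis .
qed

lemma schatten_norm_eq_0_iff:
  fixes a :: "'h op"
  assumes a: "a \<in> C"
  shows "N a = 0 \<longleftrightarrow> a = 0"
proof
  assume "N a = 0"
  then have "norm a \<le> 0"
    using norm_le_schatten_norm[OF a] weight_0_pos by (simp add: mult_le_0_iff powr_gt_zero)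
  then show "a = 0" by simp
next
  assume "a = 0"
  then have "N a = N (op_scaleC 0 a)" by simp
  then show "N a = 0" using schatten_scaleC[OF a, of 0] by simp
qed

lemma schatten_complete:
  fixes s :: "nat \<Rightarrow> 'h op"
  assumes s: "\<And>n. s n \<in> C"
    and cauchy: "\<And>e. 0 < e \<Longrightarrow> \<exists>M. \<forall>m\<ge>M. \<forall>n\<ge>M. N (s m - s n) < e"
  shows "\<exists>a\<in>C. (\<lambda>n. N (s n - a)) \<longlonglongrightarrow> 0"
proof -
  define k where "k = weight 0 powr (1 / p)"
  have k: "0 < k" using weight_0_pos by (simp add: k_def)
  note sc = schatten_class_compact[OF s]
  have "Cauchy s"
  proof (rule CauchyI)
    fix e :: real assume "0 < e"
    then obtain M where M: "\<And>m n. M \<le> m \<Longrightarrow> M \<le> n \<Longrightarrow> N (s m - s n) < k * e"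
      using cauchy[of "k * e"] k by auto
    have "norm (s m - s n) < e" if "M \<le> m" "M \<le> n" for m n
    proof -
      have "k * norm (s m - s n) < k * e"
        using norm_le_schatten_norm[OF schatten_diff[OF s s], of m n] M[OF that] by (simp add: k_def)
      then show ?thesis using k by simp
    qed
    then show "\<exists>M. \<forall>m\<ge>M. \<forall>n\<ge>M. norm (s m - s n) < e" by blast
  qed
  then obtain a where lim: "s \<longlonglongrightarrow> a" using Cauchy_convergent convergent_def by blast
  have a: "a \<in> compact_ops" by (rule compact_ops_LIMSEQ[OF sc lim])
  \<comment> \<open>The Fatou step: for fixed n and m the truncated norm of s_m - s_l stays at most
    e as l tends to infinity, and the resulting bound does not depend on n.\<close>
  have close: "\<exists>M. \<forall>m\<ge>M. s m - a \<in> C \<and> N (s m - a) \<le> e" if e: "0 < e" for e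
  proof -
    obtain M where M: "\<And>m n. M \<le> m \<Longrightarrow> M \<le> n \<Longrightarrow> N (s m - s n) < e"
      using cauchy[OF e] by blast
    have "s m - a \<in> C \<and> N (s m - a) \<le> e" if m: "M \<le> m" for m
    proof -
      have "wnorm n (singular_value (s m - a)) \<le> e" for n
      proof (rule LIMSEQ_le_const2)
        have "(\<lambda>l. s m - s l) \<longlonglongrightarrow> s m - a" by (intro tendsto_intros lim)
        then show "(\<lambda>l. wnorm n (singular_value (s m - s l))) \<longlonglongrightarrow> wnorm n (singular_value (s m - a))"
          by (intro wnorm_tendsto singular_value_LIMSEQ[OF inf] singular_value_nonneg[OF inf]
              compact_ops_diff sc a)
        have "wnorm n (singular_value (s m - s l)) \<le> e" if "M \<le> l" for l
          using wnorm_le_schatten_norm[OF schatten_diff[OF s s], of n m l] M[OF m that] by linarith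
        then show "\<exists>L. \<forall>l\<ge>L. wnorm n (singular_value (s m - s l)) \<le> e" by blast
      qed
      then show ?thesis
        using schatten_classI[OF compact_ops_diff[OF sc[of m] a], of e] e by simp
    qed
    then show ?thesis by blast
  qed
  \<comment> \<open>One such m suffices, as a = s_m - (s_m - a).\<close>
  obtain m where "s m - a \<in> C" using close[of 1] by auto
  from schatten_diff[OF s this, of m] have "a \<in> C" by (simp only: diff_diff_eq2 add_diff_cancel_left')
  moreover have "(\<lambda>n. N (s n - a)) \<longlonglongrightarrow> 0"
  proof (rule LIMSEQ_I)
    fix r :: real assume "0 < r"
    then obtain M where M: "\<And>m. M \<le> m \<Longrightarrow> N (s m - a) \<le> r / 2"
      using close[of "r / 2"] by auto
    have "norm (N (s m - a) - 0) < r" if "M \<le> m" for m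
      using M[OF that] \<open>0 < r\<close> by simp
    then show "\<exists>M. \<forall>m\<ge>M. norm (N (s m - a) - 0) < r" by blast
  qed
  ultimately show ?thesis by blast
qed

lemma schatten_subspace: "opvec.subspace C"
  unfolding opvec.subspace_def
  using zero_in_schatten_class schatten_add(1) schatten_scaleC_le(1) by blast

lemma schatten_banach_space: "op_banach_space C N"
  unfolding op_banach_space_def
proof (intro conjI ballI allI impI)
  show "\<exists>a\<in>C. (\<lambda>n. N (s n - a)) \<longlonglongrightarrow> 0"
    if "\<forall>n. s n \<in> C" "\<forall>e>0. \<exists>M. \<forall>m\<ge>M. \<forall>n\<ge>M. N (s m - s n) < e" for s :: "nat \<Rightarrow> 'h op"
    using that by (intro schatten_complete) auto
qed (simp_all add: schatten_subspace schatten_norm_eq_0_iff schatten_scaleC schatten_add)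

lemma schatten_star_ideal: "star_ideal C"
  unfolding star_ideal_def
proof (intro conjI ballI)
  show "C \<subseteq> bounded_ops" using schatten_class_compact compact_ops_bounded by blast
  show "opvec.subspace C" by (rule schatten_subspace)
  fix a :: "'h op" assume a: "a \<in> C"
  note ac = schatten_class_compact[OF a]
  show "adj a \<in> C"
    using schatten_dominated(1)[OF compact_ops_adj[OF ac] a, of 1] sum_singular_value_adj[OF inf ac] by simp
  fix b :: "'h op" assume b: "b \<in> bounded_ops"
  show "a o\<^sub>L b \<in> C"
    by (rule schatten_dominated(1)[OF compact_ops_compose_right[OF ac b] a norm_ge_zero])
       (rule sum_singular_value_compose_right[OF inf ac b])
  show "b o\<^sub>L a \<in> C"
    by (rule schatten_dominated(1)[OF compact_ops_compose_left[OF ac b] a norm_ge_zero])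
       (rule sum_singular_value_compose_left[OF inf ac b])
qed

end

end

theorem theorem4p9:
  fixes \<alpha> :: "nat \<Rightarrow> real" and p :: real
  assumes "separable_space (euclidean :: 'h::complex_hilbert_space topology)"
    and "\<nexists>B :: 'h set. finite B \<and> cvec.span B = UNIV"
    and "1 \<le> p"
    and "\<And>i. 0 \<le> \<alpha> i"
    and "mono \<alpha>"
    and "\<alpha> 0 = 0"
    and "0 < \<alpha> 1"
    and "\<And>i. 1 \<le> i \<Longrightarrow> (\<alpha> (i + 1) + \<alpha> (i - 1)) / 2 \<le> \<alpha> i"
  shows "op_banach_space (schatten_class \<alpha> p :: 'h op set) (\<lambda>a. enn2real (schatten_norm \<alpha> p a))
    \<and> star_ideal (schatten_class \<alpha> p :: 'h op set)"
proof -
  interpret concave_weight \<alpha> p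
    by unfold_locales (use assms in auto)
  show ?thesis
    using schatten_banach_space[OF assms(2)] schatten_star_ideal[OF assms(2)] by simp
qed

end
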